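(* Let $R>0$ be a real number, $d$ a positive integer, $\mathcal{C}$ a smooth analytic complex curve (i.e. a Riemann surface) and $A\in \mathrm{Aut}(\mathcal{C})$ of order $d$ (i.e. $A,\dots,A^{d-1}\neq \mathrm{Id}_\mathcal{C}$ and $A^d=\mathrm{Id}_\mathcal{C}$). Let $u:\mathbb{D}(0,R)\to\mathcal{C}$ and $\lambda:\mathcal{C}\to\mathbb{C}$ be two holomorphic maps and let $g$ be a complex-valued function defined and holomorphic in a neighbourhood of the closure $\overline{\{u(z): z\in\mathbb{D}(0,R)\}}\subset\mathcal{C}$. Denote by $\sum_{n\in\mathbb{N}} a_n z^n$ the power series expansion of $g\circ u$ near $z=0$. Assume that: i) $\lambda\circ u=\mathrm{id}_{\mathbb{D}(0,R)}$; ii) $u$ extends by continuity to a continuous map $\overline{\mathbb{D}(0,R)}\to\mathcal{C}$ (still denoted $u$); iii) the first derivative of $\lambda$ at $p=u(R)$ is zero on $T_p\mathcal{C}$: $D_p\lambda=0$; iv) the second derivative of $\lambda$ at $p$ is non-zero: $D^2_p\lambda\neq 0$; v) $u$ extends holomorphically to a neighbourhood of any point of $\partial\mathbb{D}(0,R)\setminus\{R e^{2i\pi k/d}: k\in\{0,\dots,d-1\}\}$; vi) the derivative of $g$ at $p$ is non-zero on $T_p\mathcal{C}$: $D_pg\neq 0$; vii) $\mathrm{Fix}(A^1)=\dots=\mathrm{Fix}(A^{d-1})=\{u(0)\}$ and for any $z\in\mathbb{D}(0,R)$, $u(e^{2i\pi/d}z)=Au(z)$; viii) there is an integer $r\in\{0,\dots,d-1\}$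 such that for any $q\in\overline{\{u(z): z\in\mathbb{D}(0,R)\}}$, $g(Aq)=e^{2i\pi r/d}g(q)$. Then for any non-negative integer $n$ with $n\not\equiv r \pmod d$ we have $a_n=0$, and there exist a non-zero constant $C$ and a unique sequence of constants $(c_l)_{l\geq1}$ such that for any positive integer $K$, as $n\to\infty$, $$a_{dn+r}=CR^{-dn}\frac{1}{n^{3/2}}\left(1+\frac{c_1}{n}+\dots+\frac{c_K}{n^K}+O\left(\frac{1}{n^{K+1}}\right)\right).$$
   Context: $\mathbb{D}(a,\rho)=\{z\in\mathbb{C}:|z-a|<\rho\}$ is the open disc. $\mathrm{Aut}(\mathcal{C})$ is the group of biholomorphisms of $\mathcal{C}$, and $\mathrm{Fix}(B)$ is the set of fixed points of $B$. Second derivative: if $c:\mathcal{U}_p\to\mathbb{C}$ is a holomorphic chart of $\mathcal{C}$ near $p$ with $c(p)=0$, the conditions $D_p\lambda=0$ and $D_p^2\lambda\ne0$ mean $(\lambda\circ c^{-1})'(0)=0$ and $(\lambda\circ c^{-1})''(0)\neq0$; given $D_p\lambda=0$, the condition $D^2_p\lambda\neq 0$ does not depend on the chart. "$u$ extends holomorphically to a neighbourhood of a boundary point $\zeta$" means there are an open neighbourhood $U$ of $\zeta$ in $\mathbb{C}$ and a holomorphic map $U\to\mathcal{C}$ agreeing with $u$ on $U\cap\mathbb{D}(0,R)$. *)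

theory Defs
  imports
    "HOL-Complex_Analysis.Complex_Analysis"
    "HOL-Library.Landau_Symbols"
    "HOL-Library.FuncSet"
    "HOL-Number_Theory.Cong"
begin

text \<open>
  The underlying space of a Riemann surface is a Hausdorff type \<open>'a\<close>; the complex structure is
  given by an atlas. Neither connectedness nor second countability is assumed, so every
  usual convention for ``Riemann surface'' is covered.
\<close>

definition complex_chart :: "'a::t2_space set \<Rightarrow> ('a \<Rightarrow> complex) \<Rightarrow> bool" where
  "complex_chart U c \<longleftrightarrow>
     open U \<and> open (c ` U) \<and> homeomorphism U (c ` U) c (inv_into U c)"

definition charts_compatible ::
    "'a::t2_space set \<Rightarrow> ('a \<Rightarrow> complex) \<Rightarrow> 'a set \<Rightarrow> ('a \<Rightarrow> complex) \<Rightarrow> bool" where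
  "charts_compatible U c V e \<longleftrightarrow>
     (e \<circ> inv_into U c) holomorphic_on c ` (U \<inter> V) \<and>
     (c \<circ> inv_into V e) holomorphic_on e ` (U \<inter> V)"

definition riemann_surface :: "('a::t2_space set \<times> ('a \<Rightarrow> complex)) set \<Rightarrow> bool" where
  "riemann_surface \<A> \<longleftrightarrow>
     (\<forall>(U, c) \<in> \<A>. complex_chart U c) \<and>
     (\<Union>(U, c) \<in> \<A>. U) = UNIV \<and>
     (\<forall>(U, c) \<in> \<A>. \<forall>(V, e) \<in> \<A>. charts_compatible U c V e)"

text \<open>Charts of the maximal atlas generated by \<open>\<A>\<close>, not only the members of \<open>\<A>\<close>.\<close>

definition holomorphic_chart ::
    "('a::t2_space set \<times> ('a \<Rightarrow> complex)) set \<Rightarrow> 'a set \<Rightarrow> ('a \<Rightarrow> complex) \<Rightarrow> bool" where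
  "holomorphic_chart \<A> U c \<longleftrightarrow>
     complex_chart U c \<and> (\<forall>(V, e) \<in> \<A>. charts_compatible U c V e)"

definition plane_atlas :: "(complex set \<times> (complex \<Rightarrow> complex)) set" where
  "plane_atlas = {(UNIV, id)}"

text \<open>
  Holomorphy on a set \<open>S\<close>, which is meant to be open; then continuity makes the sets
  \<open>c ` (S \<inter> U \<inter> f -` V)\<close> open as well.
\<close>

definition holomorphic_map_on ::
    "('a::t2_space set \<times> ('a \<Rightarrow> complex)) set \<Rightarrow> ('b::t2_space set \<times> ('b \<Rightarrow> complex)) set
      \<Rightarrow> 'a set \<Rightarrow> ('a \<Rightarrow> 'b) \<Rightarrow> bool" where
  "holomorphic_map_on \<A> \<B> S f \<longleftrightarrow>
     continuous_on S f \<and>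
     (\<forall>(U, c) \<in> \<A>. \<forall>(V, e) \<in> \<B>.
        (e \<circ> f \<circ> inv_into U c) holomorphic_on c ` (S \<inter> U \<inter> f -` V))"

definition automorphism ::
    "('a::t2_space set \<times> ('a \<Rightarrow> complex)) set \<Rightarrow> ('a \<Rightarrow> 'a) \<Rightarrow> bool" where
  "automorphism \<A> A \<longleftrightarrow>
     bij A \<and> holomorphic_map_on \<A> \<A> UNIV A \<and> holomorphic_map_on \<A> \<A> UNIV (inv A)"

lemma inv_into_UNIV_id [simp]: "inv_into UNIV id = (id :: 'a \<Rightarrow> 'a)"
  by (rule ext) (metis id_apply inv_id)

lemma riemann_surface_plane: "riemann_surface plane_atlas"
  by (auto simp: riemann_surface_def plane_atlas_def complex_chart_def charts_compatible_def
      homeomorphism_def holomorphic_on_id continuous_on_id)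

lemma holomorphic_map_on_plane:
  "holomorphic_map_on plane_atlas plane_atlas S f \<longleftrightarrow> f holomorphic_on S"
  by (auto simp: holomorphic_map_on_def plane_atlas_def intro: holomorphic_on_imp_continuous_on)

lemma holomorphic_chart_member:
  assumes "riemann_surface \<A>" "(U, c) \<in> \<A>"
  shows "holomorphic_chart \<A> U c"
  using assms by (auto simp: riemann_surface_def holomorphic_chart_def)

lemma centred_holomorphic_chart_exists:
  assumes "riemann_surface \<A>"
  obtains U c where "holomorphic_chart \<A> U c" "p \<in> U" "c p = 0"
proof -
  obtain U c where Uc: "(U, c) \<in> \<A>" "p \<in> U"
    using assms UNIV_I[of p] unfolding riemann_surface_def by blast
  have hc: "holomorphic_chart \<A> U c"
    using holomorphic_chart_member[OF assms Uc(1)] .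
  define b where "b = (\<lambda>q. c q - c p)"
  have inj: "inj_on c U"
    using hc by (auto simp: holomorphic_chart_def complex_chart_def homeomorphism_def
        intro: inj_on_inverseI)
  have injb: "inj_on b U"
    using inj by (auto simp: b_def inj_on_def)
  have img: "b ` T = (\<lambda>z. z - c p) ` (c ` T)" for T
    by (auto simp: b_def image_image)
  have inv: "inv_into U b z = inv_into U c (z + c p)" if z: "z \<in> b ` U" for z
  proof -
    obtain q where q: "q \<in> U" "z = b q" using z by blast
    then have "inv_into U b z = q" using injb by simp
    moreover have "z + c p = c q" using q by (simp add: b_def)
    ultimately show ?thesis using inj q by simp
  qed
  have op: "open (b ` U)"
    using hc open_translation_subtract[of "c ` U" "c p"]
    by (simp add: img holomorphic_chart_def complex_chart_def)
  have "homeomorphism U (b ` U) b (inv_into U b)"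
  proof (rule homeomorphismI)
    show "continuous_on U b"
      using hc by (auto simp: b_def holomorphic_chart_def complex_chart_def homeomorphism_def
          intro!: continuous_intros)
    have "continuous_on (b ` U) (\<lambda>z. inv_into U c (z + c p))"
      by (rule continuous_on_compose2[of "c ` U"])
         (use hc in \<open>auto simp: b_def holomorphic_chart_def complex_chart_def homeomorphism_def
           intro!: continuous_intros\<close>)
    then show "continuous_on (b ` U) (inv_into U b)"
      using inv by (simp cong: continuous_on_cong)
  qed (use injb in \<open>auto simp: inv_into_into\<close>)
  then have chart: "complex_chart U b"
    using hc op by (simp add: complex_chart_def holomorphic_chart_def)
  have "charts_compatible U b V e" if "(V, e) \<in> \<A>" for V e
  proof -
    have comp: "charts_compatible U c V e"
      using hc that by (auto simp: holomorphic_chart_def)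
    have "((e \<circ> inv_into U c) \<circ> (\<lambda>z. z + c p)) holomorphic_on b ` (U \<inter> V)"
      by (rule holomorphic_on_compose_gen[where t = "c ` (U \<inter> V)"])
         (use comp in \<open>auto simp: charts_compatible_def b_def intro!: holomorphic_intros\<close>)
    moreover have "(e \<circ> inv_into U b) z = ((e \<circ> inv_into U c) \<circ> (\<lambda>z. z + c p)) z"
      if "z \<in> b ` (U \<inter> V)" for z
      using that inv by auto
    ultimately have 1: "(e \<circ> inv_into U b) holomorphic_on b ` (U \<inter> V)"
      by (metis (no_types, lifting) holomorphic_transform)
    have "(\<lambda>z. (c \<circ> inv_into V e) z - c p) holomorphic_on e ` (U \<inter> V)"
      using comp by (auto simp: charts_compatible_def simp del: o_apply intro!: holomorphic_intros)
    then have "(b \<circ> inv_into V e) holomorphic_on e ` (U \<inter> V)"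
      by (simp add: b_def o_def)
    with 1 show ?thesis by (simp add: charts_compatible_def)
  qed
  with chart have "holomorphic_chart \<A> U b"
    by (auto simp: holomorphic_chart_def)
  with that[of U b] Uc show thesis by (simp add: b_def)
qed

end

theory Submission
  imports Defs
begin

text \<open>
  The rotation symmetry gives \<open>g (u z) = z ^ r * \<phi> ((z / R) ^ d)\<close>, where \<open>\<phi>\<close> has the coefficients
  \<open>a_(dn+r) * R ^ (dn)\<close>. In the chart at \<open>p\<close>, \<open>1 - (lam / R) ^ d\<close> has a double zero, hence equals
  \<open>\<psi>\<^sup>2\<close> with \<open>\<psi>\<close> locally biholomorphic; since \<open>lam (u z) = z\<close>, this makes \<open>\<psi> (u z)\<close> a branch of the
  square root of \<open>1 - (z / R) ^ d\<close>. So \<open>\<phi>\<close> extends across every point of the unit circle but \<open>1\<close>,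
  where \<open>\<phi> y = G (csqrt (1 - y))\<close> with \<open>G\<close> analytic at \<open>0\<close> and \<open>G' 0 \<noteq> 0\<close>.

  Darboux's method then yields the coefficients: subtracting the terms of \<open>G\<close> of order below \<open>2 N\<close>
  leaves a function whose \<open>N\<close>-th derivative is bounded on the disc, so its coefficients are
  \<open>O (n powr -N)\<close>. The subtracted half-integer powers of \<open>1 - y\<close> have binomial coefficients, whose ratios
  of consecutive terms are analytic in \<open>1 / n\<close>; summing their differences produces the full
  expansion in powers of \<open>1 / n\<close>.
\<close>

text \<open>The substitution \<open>y = (z / R) ^ d\<close> merges the \<open>d\<close> exceptional
  boundary points, which the rotation permutes, into the single point \<open>1\<close>.

  The identity \<open>\<psi> (u z) ^ 2 = 1 - (z / R) ^ d\<close> fixes the square root only up to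
  sign. On the part of the disc near \<open>R\<close>, which is convex, the sign cannot jump, and it
  enters \<open>G\<close> as a constant factor of the argument.

  Three hypotheses meet in \<open>G' 0 \<noteq> 0\<close>: iv makes \<open>\<psi>\<close>
  invertible, vi gives \<open>g\<close> a first-order term, and iii keeps the factor
  \<open>z ^ r\<close>, which \<open>\<phi>\<close> divides out, from disturbing it.

  Even powers of \<open>csqrt (1 - y)\<close> are polynomials in \<open>y\<close> and leave no trace
  in coefficients of large index. The odd ones are the half-integer powers, the lowest with
  coefficient \<open>G' 0\<close>; this gives \<open>C = G' 0 / Gamma (- (1 / 2))\<close>. The terms
  of \<open>G\<close> below order \<open>2 N\<close> are removed because each derivative in
  \<open>y\<close> lowers the order in \<open>csqrt (1 - y)\<close> by two.\<close>

section \<open>Asymptotic expansions in powers of 1/n\<close>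

text \<open>
  The degree of the approximating polynomial is deliberately not bounded by \<open>K\<close>, so that expansions
  can be multiplied without truncating; coefficients from index \<open>K\<close> on carry no information.
\<close>

definition expands :: "nat \<Rightarrow> (nat \<Rightarrow> complex) \<Rightarrow> bool" where
  "expands K f \<longleftrightarrow>
     (\<exists>p. (\<lambda>n. f n - poly p (1 / of_nat n)) \<in> O(\<lambda>n. 1 / of_nat n ^ K))"

lemma inverse_nat_tendsto_0: "(\<lambda>n. 1 / of_nat n :: complex) \<longlonglongrightarrow> 0"
  using lim_1_over_n by simp

lemma tendsto_poly_inverse_nat: "(\<lambda>n. poly p (1 / of_nat n :: complex)) \<longlonglongrightarrow> poly p 0"
  by (rule tendsto_compose[OF _ inverse_nat_tendsto_0, where g = "poly p"])
     (use isCont_def poly_isCont in blast)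

lemma tendsto_imp_bigo_1:
  fixes f :: "nat \<Rightarrow> complex"
  assumes "f \<longlonglongrightarrow> L"
  shows "f \<in> O(\<lambda>_. 1)"
  by (rule bigoI_tendsto[of _ _ L]) (use assms in auto)

lemma inverse_power_bigo_mono:
  assumes "k \<le> K"
  shows "(\<lambda>n. 1 / of_nat n ^ K :: complex) \<in> O(\<lambda>n. 1 / of_nat n ^ k)"
proof (rule bigoI[where c = 1])
  show "\<forall>\<^sub>F n in sequentially. norm (1 / of_nat n ^ K :: complex) \<le> 1 * norm (1 / of_nat n ^ k :: complex)"
    using eventually_gt_at_top[of 0]
  proof eventually_elim
    case (elim n)
    then show ?case using assms by (simp add: norm_divide norm_power field_simps power_increasing)
  qed
qed

lemma bigo_inverse_power_imp_tendsto_0: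
  assumes "f \<in> O(\<lambda>n. 1 / of_nat n ^ Suc K :: complex)"
  shows "f \<longlonglongrightarrow> 0"
proof -
  have "f \<in> O(\<lambda>n. 1 / of_nat n)"
    using landau_o.big_trans[OF assms inverse_power_bigo_mono[of 1 "Suc K"]] by simp
  moreover have "(\<lambda>n. 1 / of_nat n :: complex) \<in> o(\<lambda>_. 1)"
    by (rule smalloI_tendsto) (use inverse_nat_tendsto_0 in auto)
  ultimately have "f \<in> o(\<lambda>_. 1)" by (rule landau_o.big_small_trans)
  from smalloD_tendsto[OF this] show ?thesis by simp
qed

lemma nat_mult_bigo_inverse_power:
  assumes "f \<in> O(\<lambda>n. 1 / of_nat n ^ Suc K :: complex)"
  shows "(\<lambda>n. of_nat n * f n) \<in> O(\<lambda>n. 1 / of_nat n ^ K)"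
proof -
  have "(\<lambda>n. of_nat n * f n) \<in> O(\<lambda>n. of_nat n * (1 / of_nat n ^ Suc K))"
    by (intro landau_o.big.mult assms) simp
  also have "(\<lambda>n. of_nat n * (1 / of_nat n ^ Suc K)) \<in> O(\<lambda>n. 1 / of_nat n ^ K :: complex)"
    by (rule bigoI[where c = 1], use eventually_gt_at_top[of 0] in eventually_elim) simp
  finally show ?thesis .
qed

section \<open>Closure properties of the class of expandable sequences\<close>

lemma expands_cong:
  assumes "expands K f" "\<forall>\<^sub>F n in sequentially. f n = g n"
  shows "expands K g"
proof -
  obtain p where p: "(\<lambda>n. f n - poly p (1 / of_nat n)) \<in> O(\<lambda>n. 1 / of_nat n ^ K)"
    using assms(1) unfolding expands_def by blast
  have "\<forall>\<^sub>F n in sequentially. f n - poly p (1 / of_nat n) = g n - poly p (1 / of_nat n)"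
    using assms(2) by eventually_elim simp
  from landau_o.big.in_cong[OF this] p show ?thesis unfolding expands_def by blast
qed

lemma expands_0_iff: "expands 0 f \<longleftrightarrow> f \<in> O(\<lambda>_. 1)"
proof
  assume "expands 0 f"
  then obtain p where p: "(\<lambda>n. f n - poly p (1 / of_nat n)) \<in> O(\<lambda>_. 1)"
    unfolding expands_def by auto
  show "f \<in> O(\<lambda>_. 1)"
    using sum_in_bigo(1)[OF p tendsto_imp_bigo_1[OF tendsto_poly_inverse_nat[of p]]] by simp
next
  assume "f \<in> O(\<lambda>_. 1)"
  then show "expands 0 f" unfolding expands_def by (intro exI[of _ 0]) simp
qed

lemma expands_mono:
  assumes "expands K f" "k \<le> K"
  shows "expands k f"
  using assms inverse_power_bigo_mono[OF assms(2)] unfolding expands_def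
  by (meson landau_o.big_trans)

lemma expands_imp_bigo_1: "expands K f \<Longrightarrow> f \<in> O(\<lambda>_. 1)"
  using expands_mono[of K f 0] by (simp add: expands_0_iff)

lemma expands_of_bigo: "f \<in> O(\<lambda>n. 1 / of_nat n ^ K) \<Longrightarrow> expands K f"
  unfolding expands_def by (rule exI[of _ 0]) simp

lemma expands_poly: "expands K (\<lambda>n. poly p (1 / of_nat n))"
  unfolding expands_def by (rule exI[of _ p]) simp

lemma expands_const: "expands K (\<lambda>n. a)"
  using expands_poly[of K "[:a:]"] by simp

lemma expands_add:
  assumes "expands K f" "expands K g"
  shows "expands K (\<lambda>n. f n + g n)"
proof -
  obtain p q where p: "(\<lambda>n. f n - poly p (1 / of_nat n)) \<in> O(\<lambda>n. 1 / of_nat n ^ K)"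
    and q: "(\<lambda>n. g n - poly q (1 / of_nat n)) \<in> O(\<lambda>n. 1 / of_nat n ^ K)"
    using assms unfolding expands_def by blast
  have "(\<lambda>n. f n + g n - poly (p + q) (1 / of_nat n)) \<in> O(\<lambda>n. 1 / of_nat n ^ K)"
    using sum_in_bigo(1)[OF p q] by (simp add: algebra_simps)
  then show ?thesis unfolding expands_def by blast
qed

lemma expands_mult:
  assumes "expands K f" "expands K g"
  shows "expands K (\<lambda>n. f n * g n)"
proof -
  obtain p q where p: "(\<lambda>n. f n - poly p (1 / of_nat n)) \<in> O(\<lambda>n. 1 / of_nat n ^ K)"
    and q: "(\<lambda>n. g n - poly q (1 / of_nat n)) \<in> O(\<lambda>n. 1 / of_nat n ^ K)"
    using assms unfolding expands_def by blast
  have A: "(\<lambda>n. (f n - poly p (1 / of_nat n)) * g n) \<in> O(\<lambda>n. 1 / of_nat n ^ K)"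
    using landau_o.big.mult[OF p expands_imp_bigo_1[OF assms(2)]] by simp
  have B: "(\<lambda>n. poly p (1 / of_nat n) * (g n - poly q (1 / of_nat n))) \<in> O(\<lambda>n. 1 / of_nat n ^ K)"
    using landau_o.big.mult[OF tendsto_imp_bigo_1[OF tendsto_poly_inverse_nat[of p]] q] by simp
  have "(\<lambda>n. f n * g n - poly (p * q) (1 / of_nat n)) \<in> O(\<lambda>n. 1 / of_nat n ^ K)"
    using sum_in_bigo(1)[OF A B] by (simp add: algebra_simps)
  then show ?thesis unfolding expands_def by blast
qed

lemma expands_cmult: "expands K f \<Longrightarrow> expands K (\<lambda>n. a * f n)"
  by (intro expands_mult expands_const)

lemma expands_sum: "(\<And>i. i \<in> I \<Longrightarrow> expands K (f i)) \<Longrightarrow> expands K (\<lambda>n. \<Sum>i\<in>I. f i n)"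
  by (induction I rule: infinite_finite_induct) (auto intro: expands_add expands_const)

lemma expands_divide_nat:
  assumes "expands K f"
  shows "expands (Suc K) (\<lambda>n. f n / of_nat n)"
proof -
  obtain p where p: "(\<lambda>n. f n - poly p (1 / of_nat n)) \<in> O(\<lambda>n. 1 / of_nat n ^ K)"
    using assms unfolding expands_def by blast
  have "(\<lambda>n. (f n - poly p (1 / of_nat n)) * (1 / of_nat n)) \<in> O(\<lambda>n. 1 / of_nat n ^ K * (1 / of_nat n))"
    by (intro landau_o.big.mult p) simp
  then have "(\<lambda>n. f n / of_nat n - poly (pCons 0 p) (1 / of_nat n)) \<in> O(\<lambda>n. 1 / of_nat n ^ Suc K)"
    by (simp add: algebra_simps)
  then show ?thesis unfolding expands_def by blast
qed

text \<open>Converse to \<open>expands_divide_nat\<close>: peeling off the constant term trades one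
  order for an explicit factor \<open>1 / n\<close>. This drives the induction in
  \<open>expands_of_difference\<close>.\<close>

lemma expands_Suc_decompose:
  assumes "expands (Suc K) f"
  obtains a e where "expands K e" "\<forall>\<^sub>F n in sequentially. f n = a + e n / of_nat n"
proof -
  obtain p where p: "(\<lambda>n. f n - poly p (1 / of_nat n)) \<in> O(\<lambda>n. 1 / of_nat n ^ Suc K)"
    using assms unfolding expands_def by blast
  obtain a q where pq: "p = pCons a q" by (cases p)
  define e where "e = (\<lambda>n. of_nat n * (f n - a))"
  have "\<forall>\<^sub>F n in sequentially. of_nat n * (f n - poly p (1 / of_nat n)) = e n - poly q (1 / of_nat n)"
    using eventually_gt_at_top[of 0]
    by eventually_elim (simp add: e_def pq field_simps)
  from landau_o.big.in_cong[OF this] nat_mult_bigo_inverse_power[OF p]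
  have "(\<lambda>n. e n - poly q (1 / of_nat n)) \<in> O(\<lambda>n. 1 / of_nat n ^ K)"
    by simp
  then have "expands K e" unfolding expands_def by blast
  moreover have "\<forall>\<^sub>F n in sequentially. f n = a + e n / of_nat n"
    using eventually_gt_at_top[of 0] by eventually_elim (simp add: e_def)
  ultimately show thesis by (rule that)
qed

text \<open>Once \<open>h 0\<close> is split off, the rest is \<open>1 / n\<close> times the
  difference quotient, which is again analytic (removable singularity). The division by
  \<open>n\<close> gains one order, so the quotient is needed to order \<open>K\<close>
  only.\<close>

lemma expands_analytic:
  assumes "h analytic_on {0}"
  shows "expands K (\<lambda>n. h (1 / of_nat n))"
  using assms
proof (induction K arbitrary: h)
  case 0
  have "(\<lambda>n. h (1 / of_nat n)) \<longlonglongrightarrow> h 0"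
    by (rule isCont_tendsto_compose[OF _ inverse_nat_tendsto_0])
       (use 0 analytic_at_imp_isCont in blast)
  then show ?case by (simp add: expands_0_iff tendsto_imp_bigo_1)
next
  case (Suc K)
  obtain S where S: "open S" "0 \<in> S" "h holomorphic_on S"
    using Suc.prems analytic_at by blast
  define k where "k = (\<lambda>z. if z = 0 then deriv h 0 else (h z - h 0) / (z - 0))"
  have "k holomorphic_on S" unfolding k_def by (rule pole_lemma_open) (use S in auto)
  then have "k analytic_on {0}" using S analytic_at by blast
  then have "expands (Suc K) (\<lambda>n. h 0 + k (1 / of_nat n) / of_nat n)"
    by (intro expands_add expands_const expands_divide_nat Suc.IH)
  then show ?case
    by (rule expands_cong, use eventually_gt_at_top[of 0] in eventually_elim)
       (simp add: k_def field_simps)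
qed

text \<open>The constant coefficient is the limit along \<open>1 / n\<close>, hence zero;
  multiplication by \<open>n\<close> then shifts the polynomial and lowers \<open>K\<close> by one.
  Consistency and uniqueness of expansion coefficients both rest on this.\<close>

lemma poly_bigo_imp_coeff_0:
  fixes p :: "complex poly"
  assumes "(\<lambda>n. poly p (1 / of_nat n)) \<in> O(\<lambda>n. 1 / of_nat n ^ K)" "l < K"
  shows "coeff p l = 0"
  using assms
proof (induction K arbitrary: p l)
  case (Suc K)
  obtain a q where pq: "p = pCons a q" by (cases p)
  have "poly p 0 = 0"
    using bigo_inverse_power_imp_tendsto_0[OF Suc.prems(1)] tendsto_poly_inverse_nat[of p] LIMSEQ_unique by blast
  then have a: "a = 0" by (simp add: pq)
  have "\<forall>\<^sub>F n in sequentially. of_nat n * poly p (1 / of_nat n) = poly q (1 / of_nat n)"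
    using eventually_gt_at_top[of 0]
    by eventually_elim (simp add: pq a field_simps)
  from landau_o.big.in_cong[OF this] nat_mult_bigo_inverse_power[OF Suc.prems(1)]
  have "(\<lambda>n. poly q (1 / of_nat n)) \<in> O(\<lambda>n. 1 / of_nat n ^ K)"
    by simp
  note IH = Suc.IH[OF this]
  show ?case
  proof (cases l)
    case 0
    then show ?thesis by (simp add: pq a)
  next
    case (Suc m)
    then show ?thesis using IH[of m] Suc.prems(2) by (simp add: pq)
  qed
qed (use not_less_zero in blast)

lemma poly_truncate_bigo:
  fixes p :: "complex poly"
  shows "(\<lambda>n. poly p (1 / of_nat n) - (\<Sum>l<K. coeff p l / of_nat n ^ l)) \<in> O(\<lambda>n. 1 / of_nat n ^ K)"
proof -
  \<comment> \<open>The upper limit exceeds both the degree and \<open>K\<close>, so the full sum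
    can be split at \<open>K\<close> even when the degree is smaller.\<close>
  have *: "(\<lambda>n. \<Sum>l\<in>{K..<Suc (degree p) + K}. coeff p l * (1 / of_nat n ^ l)) \<in> O(\<lambda>n. 1 / of_nat n ^ K :: complex)"
  proof (rule big_sum_in_bigo)
    fix l assume "l \<in> {K..<Suc (degree p) + K}"
    then show "(\<lambda>n. coeff p l * (1 / of_nat n ^ l)) \<in> O(\<lambda>n. 1 / of_nat n ^ K :: complex)"
      using landau_o.big.mult[OF bigo_const[of "coeff p l"] inverse_power_bigo_mono[of K l]] by simp
  qed
  have "poly p x - (\<Sum>l<K. coeff p l * x ^ l) = (\<Sum>l\<in>{K..<Suc (degree p) + K}. coeff p l * x ^ l)" for x
  proof -
    have "poly p x = (\<Sum>l<Suc (degree p) + K. coeff p l * x ^ l)"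
      unfolding poly_altdef by (rule sum.mono_neutral_left) (auto simp: coeff_eq_0)
    also have "\<dots> = (\<Sum>l<K. coeff p l * x ^ l) + (\<Sum>l\<in>{K..<Suc (degree p) + K}. coeff p l * x ^ l)"
      using sum.atLeastLessThan_concat[of 0 K "Suc (degree p) + K" "\<lambda>l. coeff p l * x ^ l"]
      by (simp add: lessThan_atLeast0)
    finally show ?thesis by simp
  qed
  from this[of "1 / of_nat _"] * show ?thesis by (simp add: power_one_over)
qed

section \<open>Taylor quotients and summation of differences\<close>

lemma analytic_taylor_1:
  fixes h :: "complex \<Rightarrow> complex"
  assumes "h analytic_on {0}"
  obtains k where "k analytic_on {0}" "k 0 = deriv h 0" "\<And>x. h x = h 0 + x * k x"
proof -
  obtain S where S: "open S" "0 \<in> S" "h holomorphic_on S"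
    using assms analytic_at by blast
  define k where "k = (\<lambda>z. if z = 0 then deriv h 0 else (h z - h 0) / (z - 0))"
  have "k holomorphic_on S" unfolding k_def by (rule pole_lemma_open) (use S in auto)
  then have "k analytic_on {0}" using S analytic_at by blast
  then show thesis by (rule that) (auto simp: k_def)
qed

text \<open>The identity holds at every \<open>x\<close>, not only near \<open>0\<close>, because
  \<open>k\<close> is a difference quotient formed pointwise from the total function
  \<open>h\<close>; only its analyticity is local. Applications thus carry no side condition on
  \<open>x\<close>.\<close>

lemma analytic_taylor_2:
  fixes h :: "complex \<Rightarrow> complex"
  assumes "h analytic_on {0}"
  obtains k where "k analytic_on {0}" "\<And>x. h x = h 0 + x * (deriv h 0 + x * k x)"
proof -
  obtain k1 where k1: "k1 analytic_on {0}" "k1 0 = deriv h 0" "\<And>x. h x = h 0 + x * k1 x"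
    using analytic_taylor_1[OF assms] by blast
  obtain k where k: "k analytic_on {0}" "\<And>x. k1 x = k1 0 + x * k x"
    using analytic_taylor_1[OF k1(1)] by blast
  have "h x = h 0 + x * (deriv h 0 + x * k x)" for x
    using k1(3)[of x] k(2)[of x] by (simp only: k1(2))
  with k(1) show thesis by (rule that)
qed

text \<open>The bound \<open>1 / m^2 \<le> 1 / (m - 1) - 1 / m\<close> makes the differences
  telescope, while the remaining factor \<open>1 / m ^ j\<close> is estimated at the first index.
  The telescoped sum supplies the last factor \<open>1 / n\<close>, and letting the end index grow
  replaces \<open>f (n + k)\<close> by \<open>L\<close>.\<close>

lemma tail_bigo:
  fixes f :: "nat \<Rightarrow> complex"
  assumes lim: "f \<longlonglongrightarrow> L"
    and diff: "(\<lambda>n. f (Suc n) - f n) \<in> O(\<lambda>n. 1 / of_nat n ^ (j + 2))"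
  shows "(\<lambda>n. f n - L) \<in> O(\<lambda>n. 1 / of_nat n ^ Suc j)"
proof -
  obtain C where C: "C > 0"
    "\<forall>\<^sub>F n in sequentially. norm (f (Suc n) - f n) \<le> C * norm (1 / of_nat n ^ (j + 2) :: complex)"
    using landau_o.bigE[OF diff] by blast
  then obtain N where N: "\<And>n. n \<ge> N \<Longrightarrow> norm (f (Suc n) - f n) \<le> C / real n ^ (j + 2)"
    unfolding eventually_sequentially by (auto simp: norm_divide norm_power norm_mult)
  have tail: "norm (f (n + k) - f n) \<le> C / real n ^ j * (1 / (real n - 1) - 1 / (real (n + k) - 1))"
    if n: "n \<ge> N" "n \<ge> 2" for n k
  proof (induction k)
    case (Suc k)
    define m where "m = real (n + k)"
    have m: "m \<ge> 2" "m \<ge> real n" using n by (auto simp: m_def)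
    have "norm (f (n + Suc k) - f (n + k)) \<le> C / m ^ (j + 2)"
      using N[of "n + k"] n by (simp add: m_def)
    also have "\<dots> = C / m ^ j * (1 / m\<^sup>2)"
      by (simp add: power_add power2_eq_square)
    also have "\<dots> \<le> C / real n ^ j * (1 / (m - 1) - 1 / m)"
    proof (rule mult_mono)
      show "C / m ^ j \<le> C / real n ^ j"
        using m n C(1) by (intro divide_left_mono power_mono) auto
      have "1 / m\<^sup>2 \<le> 1 / ((m - 1) * m)"
        using m by (intro divide_left_mono) (auto simp: power2_eq_square)
      also have "\<dots> = 1 / (m - 1) - 1 / m"
        using m by (simp add: field_simps)
      finally show "1 / m\<^sup>2 \<le> 1 / (m - 1) - 1 / m" .
    qed (use m n C(1) in auto)
    finally have step: "norm (f (n + Suc k) - f (n + k)) \<le> C / real n ^ j * (1 / (m - 1) - 1 / m)" .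
    have "norm (f (n + Suc k) - f n) \<le> norm (f (n + Suc k) - f (n + k)) + norm (f (n + k) - f n)"
      by (rule order_trans[OF _ norm_triangle_ineq]) simp
    also have "\<dots> \<le> C / real n ^ j * (1 / (m - 1) - 1 / m) + C / real n ^ j * (1 / (real n - 1) - 1 / (m - 1))"
      using step Suc by (simp add: m_def)
    also have "\<dots> = C / real n ^ j * (1 / (real n - 1) - 1 / m)"
      by (simp add: algebra_simps)
    finally show ?case by (simp add: m_def)
  qed simp
  have "norm (f n - L) \<le> (2 * C) / real n ^ Suc j" if n: "n \<ge> N" "n \<ge> 2" for n
  proof -
    have "norm (f (n + k) - f n) \<le> C / real n ^ j * (2 / real n)" for k
    proof -
      have "1 / (real n - 1) \<le> 2 / real n" using n by (simp add: field_simps)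
      moreover have "0 \<le> 1 / (real (n + k) - 1)" using n by simp
      ultimately have "1 / (real n - 1) - 1 / (real (n + k) - 1) \<le> 2 / real n" by linarith
      then show ?thesis
        by (intro order_trans[OF tail[OF n]] mult_left_mono) (use C in auto)
    qed
    moreover have "(\<lambda>k. norm (f (n + k) - f n)) \<longlonglongrightarrow> norm (L - f n)"
      using LIMSEQ_ignore_initial_segment[OF lim, of n]
      by (intro tendsto_intros) (simp add: add.commute)
    ultimately have "norm (L - f n) \<le> C / real n ^ j * (2 / real n)"
      by (intro LIMSEQ_le_const2) auto
    then show ?thesis by (simp add: norm_minus_commute mult_ac)
  qed
  then show ?thesis
    by (intro bigoI[where c = "2 * C"])
       (auto simp: norm_divide norm_power norm_mult eventually_sequentially intro!: exI[of _ "max N 2"])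
qed

text \<open>With \<open>x = 1 / n\<close> this is the Taylor expansion of
  \<open>1 / (1 + x) ^ Suc j\<close> at \<open>0\<close>, scaled by \<open>x ^ Suc j\<close>. The
  coefficient \<open>- Suc j\<close> determines the correction term in
  \<open>expands_of_difference\<close>.\<close>

lemma inverse_power_difference:
  obtains k where "k analytic_on {0}"
    "\<And>n. n > 0 \<Longrightarrow> 1 / of_nat (Suc n) ^ Suc j - 1 / of_nat n ^ Suc j =
       (- of_nat (Suc j) + k (1 / of_nat n :: complex) / of_nat n) / of_nat n ^ (j + 2)"
proof -
  define h where "h = (\<lambda>x::complex. 1 / (1 + x) ^ Suc j)"
  have h: "h analytic_on {0}" unfolding h_def by (intro analytic_intros) auto
  have h0: "h 0 = 1" by (simp add: h_def)
  have dh: "deriv h 0 = - of_nat (Suc j)" unfolding h_def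
    by (rule DERIV_imp_deriv) (auto intro!: derivative_eq_intros simp del: power_Suc)
  obtain k where k: "k analytic_on {0}" "\<And>x. h x = 1 + x * (- of_nat (Suc j) + x * k x)"
    using analytic_taylor_2[OF h] unfolding h0 dh by blast
  note k(1)
  moreover have "1 / of_nat (Suc n) ^ Suc j - 1 / of_nat n ^ Suc j =
       (- of_nat (Suc j) + k (1 / of_nat n :: complex) / of_nat n) / of_nat n ^ (j + 2)" if n: "n > 0" for n
  proof -
    define x :: complex where "x = 1 / of_nat n"
    have x: "x \<noteq> 0" "of_nat n = 1 / x" using n by (auto simp: x_def)
    have h: "h x = 1 + x * (- of_nat (Suc j) + x * k x)" by (rule k(2))
    have nz: "1 + x \<noteq> 0" using n by (simp add: x_def field_simps) (metis of_nat_Suc of_nat_neq_0 add.commute)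
    have "1 / of_nat (Suc n) ^ Suc j = x ^ Suc j * h x"
    proof -
      have "of_nat (Suc n) = (1 + x) / x" using x by (simp add: field_simps)
      then show ?thesis by (simp only: h_def power_divide) simp
    qed
    moreover have "1 / of_nat n ^ Suc j = x ^ Suc j" by (simp only: x_def power_one_over)
    ultimately have "1 / of_nat (Suc n) ^ Suc j - 1 / of_nat n ^ Suc j = x ^ Suc j * (h x - 1)"
      by (simp only: right_diff_distrib mult_1_right)
    also have "\<dots> = (- of_nat (Suc j) + x * k x) * x ^ (j + 2)"
      by (simp add: h algebra_simps)
    finally show ?thesis
      by (simp add: x_def power_one_over)
  qed
  ultimately show thesis by (rule that)
qed

text \<open>Discrete integration, one term at a time. If the difference starts with
  \<open>a / n ^ (j + 2)\<close>, adding \<open>b / n ^ Suc j\<close> with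
  \<open>b = a / Suc j\<close> cancels that term and does not change the limit. The corrected
  sequence then falls under the induction hypothesis with \<open>K\<close> lowered and
  \<open>j\<close> raised by one.\<close>

lemma expands_of_difference:
  assumes "f \<longlonglongrightarrow> L" "expands K e"
    "\<forall>\<^sub>F n in sequentially. f (Suc n) - f n = e n / of_nat n ^ (j + 2)"
  shows "expands (K + Suc j) f"
  using assms
proof (induction K arbitrary: f L e j)
  case 0
  have "(\<lambda>n. e n * (1 / of_nat n ^ (j + 2))) \<in> O(\<lambda>n. 1 * (1 / of_nat n ^ (j + 2)))"
    using 0(2) by (intro landau_o.big.mult) (simp_all add: expands_0_iff)
  then have "(\<lambda>n. e n / of_nat n ^ (j + 2)) \<in> O(\<lambda>n. 1 / of_nat n ^ (j + 2))" by simp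
  with landau_o.big.in_cong[OF 0(3)]
  have "(\<lambda>n. f (Suc n) - f n) \<in> O(\<lambda>n. 1 / of_nat n ^ (j + 2))" by simp
  from expands_of_bigo[OF tail_bigo[OF 0(1) this]]
  have "expands (Suc j) (\<lambda>n. (f n - L) + L)" by (intro expands_add expands_const)
  then show ?case by simp
next
  case (Suc K)
  obtain a e' where e': "expands K e'" "\<forall>\<^sub>F n in sequentially. e n = a + e' n / of_nat n"
    using expands_Suc_decompose[OF Suc.prems(2)] by blast
  obtain k :: "complex \<Rightarrow> complex" where k: "k analytic_on {0}"
    "\<And>n. n > 0 \<Longrightarrow> 1 / of_nat (Suc n) ^ Suc j - 1 / of_nat n ^ Suc j =
       (- of_nat (Suc j) + k (1 / of_nat n :: complex) / of_nat n) / of_nat n ^ (j + 2)"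
    using inverse_power_difference[of j] by blast
  define b where "b = a / of_nat (Suc j)"
  define f' where "f' = (\<lambda>n. f n + b * (1 / of_nat n ^ Suc j))"
  have lim': "(\<lambda>n. b * (1 / of_nat n ^ Suc j)) \<longlonglongrightarrow> 0"
    by (intro tendsto_mult_right_zero bigo_inverse_power_imp_tendsto_0[of _ j]) simp
  have "f' \<longlonglongrightarrow> L + 0" unfolding f'_def
    by (intro tendsto_add Suc.prems lim')
  moreover have "expands K (\<lambda>n. e' n + b * k (1 / of_nat n))"
    by (intro expands_add e' expands_cmult expands_analytic k)
  moreover have "\<forall>\<^sub>F n in sequentially. f' (Suc n) - f' n = (e' n + b * k (1 / of_nat n)) / of_nat n ^ (Suc j + 2)"
    using Suc.prems(3) e'(2) eventually_gt_at_top[of 0]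
  proof eventually_elim
    case (elim n)
    have "f' (Suc n) - f' n = (f (Suc n) - f n) + b * (1 / of_nat (Suc n) ^ Suc j - 1 / of_nat n ^ Suc j)"
      unfolding f'_def by (simp only: algebra_simps)
    also have "\<dots> = (a + e' n / of_nat n + b * (- of_nat (Suc j) + k (1 / of_nat n :: complex) / of_nat n)) / of_nat n ^ (j + 2)"
      by (subst k(2)[OF elim(3)]) (simp only: elim add_divide_distrib distrib_left times_divide_eq_right)
    also have "b * (- of_nat (Suc j) + k (1 / of_nat n) / of_nat n) = - a + b * k (1 / of_nat n) / of_nat n"
      unfolding b_def by (simp only: distrib_left) (simp del: of_nat_Suc)
    also have "(a + e' n / of_nat n + (- a + b * k (1 / of_nat n) / of_nat n)) / of_nat n ^ (j + 2)
       = (e' n + b * k (1 / of_nat n)) / of_nat n ^ (Suc j + 2)"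
      using elim(3) by (simp add: add_divide_distrib)
    finally show ?case .
  qed
  ultimately have *: "expands (K + Suc (Suc j)) f'" by (rule Suc.IH)
  have "expands (K + Suc (Suc j)) (\<lambda>n. poly (monom b (Suc j)) (1 / of_nat n))" by (rule expands_poly)
  then have "expands (K + Suc (Suc j)) (\<lambda>n. b * (1 / of_nat n ^ Suc j))"
    by (simp only: poly_monom power_one_over)
  from expands_add[OF * expands_cmult[OF this, of "-1"]]
  show ?case by (simp add: f'_def)
qed

section \<open>Existence and uniqueness of the coefficients of an asymptotic series\<close>

lemma asymptotic_series_unique_existence:
  fixes w :: "nat \<Rightarrow> complex"
  assumes w: "\<And>K. expands K w" and lim: "w \<longlonglongrightarrow> C" and C: "C \<noteq> 0"
  shows "\<exists>!b. b \<in> {1::nat..} \<rightarrow>\<^sub>E (UNIV :: complex set) \<and>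
     (\<forall>K\<ge>1. \<exists>E\<in>O(\<lambda>n. 1 / of_nat n ^ (K + 1)).
        \<forall>\<^sub>F n in sequentially. w n = C * (1 + (\<Sum>l=1..K. b l / of_nat n ^ l) + E n))"
    (is "\<exists>!b. b \<in> _ \<and> ?asymp b")
proof (rule ex_ex1I)
  have "\<forall>K. \<exists>p. (\<lambda>n. w n - poly p (1 / of_nat n)) \<in> O(\<lambda>n. 1 / of_nat n ^ K)"
    using w unfolding expands_def ..
  from choice[OF this] obtain p
    where "\<forall>K. (\<lambda>n. w n - poly (p K) (1 / of_nat n)) \<in> O(\<lambda>n. 1 / of_nat n ^ K)" ..
  then have p: "(\<lambda>n. w n - poly (p K) (1 / of_nat n)) \<in> O(\<lambda>n. 1 / of_nat n ^ K)" for K ..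
  \<comment> \<open>The polynomials chosen for different orders need not extend one another, but
    below their orders their coefficients agree. Coefficient \<open>l\<close> can therefore be read
    off at \<open>Suc l\<close>, the first order that determines it.\<close>
  have stable: "coeff (p K) l = coeff (p (Suc l)) l" if "l < K" for K l
  proof -
    have "(\<lambda>n. w n - poly (p K) (1 / of_nat n)) \<in> O(\<lambda>n. 1 / of_nat n ^ Suc l)"
      by (rule landau_o.big_trans[OF p inverse_power_bigo_mono]) (use that in simp)
    from sum_in_bigo(2)[OF p[of "Suc l"] this]
    have "(\<lambda>n. poly (p K - p (Suc l)) (1 / of_nat n)) \<in> O(\<lambda>n. 1 / of_nat n ^ Suc l)"
      by simp
    from poly_bigo_imp_coeff_0[OF this lessI] show ?thesis by simp
  qed
  define B where "B l = coeff (p (Suc l)) l" for l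
  have coeff_B: "coeff (p K) l = B l" if "l < K" for K l
    unfolding B_def using that by (rule stable)
  have B: "(\<lambda>n. w n - (\<Sum>l<K. B l / of_nat n ^ l)) \<in> O(\<lambda>n. 1 / of_nat n ^ K)" for K
  proof -
    have "(\<Sum>l<K. coeff (p K) l / of_nat n ^ l) = (\<Sum>l<K. B l / of_nat n ^ l)" for n
      by (intro sum.cong refl) (simp add: coeff_B)
    with sum_in_bigo(1)[OF p[of K] poly_truncate_bigo[of "p K" K]] show ?thesis
      by simp
  qed
  have B0: "B 0 = C"
  proof -
    have "(\<lambda>n. w n - B 0) \<longlonglongrightarrow> 0"
      using B[of "Suc 0"] by (intro bigo_inverse_power_imp_tendsto_0[of _ 0]) simp
    then have "w \<longlonglongrightarrow> B 0" by (rule LIM_zero_cancel)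
    with lim LIMSEQ_unique show ?thesis by blast
  qed
  \<comment> \<open>Restriction fixes the value at \<open>0\<close>, which no expansion determines;
    this lets uniqueness be an equality of functions on all of \<open>nat\<close>.\<close>
  define b where "b = restrict (\<lambda>l. B l / C) {1..}"
  have "?asymp b"
  proof (intro allI impI)
    fix K :: nat
    define E where "E = (\<lambda>n. 1 / C * (w n - (\<Sum>l<K + 1. B l / of_nat n ^ l)))"
    have "E \<in> O(\<lambda>n. 1 / of_nat n ^ (K + 1))"
      unfolding E_def using landau_o.big.mult[OF bigo_const[of "1 / C"] B[of "K + 1"]]
      by (simp only: mult_1_left)
    moreover have "w n = C * (1 + (\<Sum>l=1..K. b l / of_nat n ^ l) + E n)" for n
    proof -
      have "(\<Sum>l<K + 1. B l / of_nat n ^ l) = C + (\<Sum>l=1..K. B l / of_nat n ^ l)"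
        using B0 by (simp add: lessThan_Suc_atMost atMost_atLeast0 sum.atLeast_Suc_atMost)
      moreover have "(\<Sum>l=1..K. B l / of_nat n ^ l) = C * (\<Sum>l=1..K. b l / of_nat n ^ l)"
        using C by (simp add: b_def sum_distrib_left)
      ultimately show ?thesis using C by (simp add: E_def field_simps)
    qed
    ultimately show "\<exists>E\<in>O(\<lambda>n. 1 / of_nat n ^ (K + 1)).
        \<forall>\<^sub>F n in sequentially. w n = C * (1 + (\<Sum>l=1..K. b l / of_nat n ^ l) + E n)"
      by (intro bexI[of _ E] always_eventually) auto
  qed
  then show "\<exists>b. b \<in> {1::nat..} \<rightarrow>\<^sub>E (UNIV :: complex set) \<and> ?asymp b"
    by (intro exI[of _ b] conjI) (auto simp: b_def)
next
  fix b b' :: "nat \<Rightarrow> complex"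
  assume b: "b \<in> {1..} \<rightarrow>\<^sub>E UNIV \<and> ?asymp b" and b': "b' \<in> {1..} \<rightarrow>\<^sub>E UNIV \<and> ?asymp b'"
  show "b = b'"
  proof
    fix K :: nat
    show "b K = b' K"
    proof (cases "K \<ge> 1")
      case True
      obtain E where E: "E \<in> O(\<lambda>n. 1 / of_nat n ^ (K + 1))"
        "\<forall>\<^sub>F n in sequentially. w n = C * (1 + (\<Sum>l=1..K. b l / of_nat n ^ l) + E n)"
        using b True by blast
      obtain E' where E': "E' \<in> O(\<lambda>n. 1 / of_nat n ^ (K + 1))"
        "\<forall>\<^sub>F n in sequentially. w n = C * (1 + (\<Sum>l=1..K. b' l / of_nat n ^ l) + E' n)"
        using b' True by blast
      \<comment> \<open>For each \<open>K\<close> only the top coefficient is compared: an error of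
        order \<open>1 / n ^ (K + 1)\<close> still determines it, so there is no induction over the
        indices.\<close>
      define q where "q = (\<Sum>l=1..K. monom (b l - b' l) l)"
      have "\<forall>\<^sub>F n in sequentially. E' n - E n = poly q (1 / of_nat n)"
        using E(2) E'(2)
      proof eventually_elim
        case (elim n)
        then have "(\<Sum>l=1..K. b l / of_nat n ^ l) + E n = (\<Sum>l=1..K. b' l / of_nat n ^ l) + E' n"
          using C by simp
        moreover have "poly q (1 / of_nat n) = (\<Sum>l=1..K. b l / of_nat n ^ l) - (\<Sum>l=1..K. b' l / of_nat n ^ l)"
          by (simp add: q_def poly_sum poly_monom power_one_over diff_divide_distrib sum_subtractf)
        ultimately show ?case by algebra
      qed
      from landau_o.big.in_cong[OF this] sum_in_bigo(2)[OF E'(1) E(1)]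
      have "(\<lambda>n. poly q (1 / of_nat n)) \<in> O(\<lambda>n. 1 / of_nat n ^ (K + 1))"
        by simp
      from poly_bigo_imp_coeff_0[OF this, of K] have "coeff q K = 0" by simp
      then show ?thesis using True by (simp add: q_def coeff_sum if_distrib cong: if_cong)
    next
      case False
      then show ?thesis using b b' by (auto simp: PiE_def extensional_def)
    qed
  qed
qed

section \<open>Half-integer binomial coefficients\<close>

text \<open>The coefficient of \<open>z ^ n\<close> in \<open>(1 - z) powr (i + 1 / 2)\<close>, times \<open>n powr (3 / 2)\<close>.\<close>

definition half_binom :: "nat \<Rightarrow> nat \<Rightarrow> complex" where
  "half_binom i n = of_real (real n powr (3 / 2)) * ((-1) ^ n * ((of_nat i + 1 / 2) gchoose n))"

text \<open>The general asymptotics of \<open>z gchoose n\<close> at \<open>z = 1 / 2\<close>: the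
  exponent \<open>3 / 2\<close> is \<open>z + 1\<close>, and the limit equals
  \<open>- 1 / (2 * sqrt pi)\<close>.\<close>

lemma tendsto_half_binom_0: "half_binom 0 \<longlonglongrightarrow> inverse (Gamma (- (1 / 2)))"
proof -
  have "\<forall>\<^sub>F n in sequentially.
     ((1 / 2) gchoose n) / ((-1) ^ n / exp ((1 / 2 + 1) * complex_of_real (ln (real n)))) = half_binom 0 n"
    using eventually_gt_at_top[of 0]
  proof eventually_elim
    case (elim n)
    have "exp ((1 / 2 + 1) * complex_of_real (ln (real n))) = exp (of_real (3 / 2 * ln (real n)))"
      by simp
    also have "\<dots> = of_real (real n powr (3 / 2))"
      unfolding exp_of_real using elim by (simp add: powr_def)
    finally show ?case
      by (simp add: half_binom_def divide_simps)
  qed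
  then show ?thesis
    by (rule Lim_transform_eventually[OF gbinomial_asymptotic])
qed

text \<open>The ratio is \<open>(1 + 1 / n) powr (3 / 2) * (n - 1 / 2) / (n + 1)\<close>, where one
  factor \<open>1 + 1 / n\<close> cancels the denominator. What remains is analytic in
  \<open>1 / n\<close>, with \<open>csqrt\<close> evaluated near \<open>1\<close>.\<close>

lemma half_binom_0_Suc:
  assumes "n > 0"
  shows "half_binom 0 (Suc n) =
    half_binom 0 n * (csqrt (1 + 1 / of_nat n) * (1 - (1 / of_nat n) / 2))"
proof -
  define N where "N = real n"
  have N: "N > 0" using assms by (simp add: N_def)
  have "real (Suc n) powr (3 / 2) = (N * (1 + 1 / N)) powr (3 / 2)"
  proof -
    have "real (Suc n) = N * (1 + 1 / N)" using N by (simp add: N_def algebra_simps)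
    then show ?thesis by (simp only:)
  qed
  also have "\<dots> = N powr (3 / 2) * (1 + 1 / N) powr (1 + 1 / 2)"
    using N by (subst powr_mult) auto
  also have "(1 + 1 / N) powr (1 + 1 / 2) = (1 + 1 / N) * sqrt (1 + 1 / N)"
    using N by (subst powr_add) (auto simp: powr_half_sqrt)
  finally have pw: "complex_of_real (real (Suc n) powr (3 / 2)) =
      of_real (N powr (3 / 2)) * ((1 + 1 / of_nat n) * of_real (sqrt (1 + 1 / N)))"
    by (simp add: N_def)
  have cs: "csqrt (1 + 1 / of_nat n) = of_real (sqrt (1 + 1 / N))"
    using N by (subst of_real_sqrt) (auto simp: N_def)
  have "(1 / 2 - of_nat n) * ((1 / 2 :: complex) gchoose n) = of_nat (Suc n) * ((1 / 2) gchoose Suc n)"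
    using gbinomial_mult_1[of "1 / 2 :: complex" n] by (simp add: algebra_simps)
  then have rec: "((1 / 2 :: complex) gchoose Suc n) = (1 / 2 - of_nat n) / of_nat (Suc n) * ((1 / 2) gchoose n)"
    by (simp add: field_simps del: of_nat_Suc)
  have "(1 + 1 / of_nat n :: complex) = of_nat (Suc n) / of_nat n"
    using assms by (simp add: field_simps)
  then have *: "(1 + 1 / of_nat n) * ((1 / 2 - of_nat n) / of_nat (Suc n)) = - (1 - (1 / of_nat n :: complex) / 2)"
    using assms by (simp add: divide_simps del: of_nat_Suc)
  have "half_binom 0 (Suc n) = of_real (N powr (3 / 2)) * (-1) ^ n * ((1 / 2) gchoose n) *
     of_real (sqrt (1 + 1 / N)) * - ((1 + 1 / of_nat n) * ((1 / 2 - of_nat n) / of_nat (Suc n)))"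
    unfolding half_binom_def pw by (simp add: rec del: of_nat_Suc)
  then show ?thesis unfolding * cs by (simp add: half_binom_def N_def)
qed

text \<open>A bootstrap from the known limit: an expansion of the sequence yields one of its
  differences, and summing these gains an order.\<close>

lemma expands_half_binom_0: "expands K (half_binom 0)"
proof (induction K)
  case 0
  then show ?case using tendsto_half_binom_0 by (simp add: expands_0_iff tendsto_imp_bigo_1)
next
  case (Suc K)
  define h :: "complex \<Rightarrow> complex" where "h = (\<lambda>x. csqrt (1 + x) * (1 - x / 2))"
  have h: "h analytic_on {0}" unfolding h_def
    by (intro analytic_intros) auto
  have h0: "h 0 = 1" by (simp add: h_def)
  \<comment> \<open>The contributions \<open>1 / 2\<close> and \<open>- 1 / 2\<close> of the two
    factors cancel. This is where \<open>3 / 2\<close> proves to be the right exponent: the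
    differences start at order \<open>1 / n^2\<close> and are summable.\<close>
  have dh: "deriv h 0 = 0"
    unfolding h_def by (rule DERIV_imp_deriv) (auto intro!: derivative_eq_intros)
  obtain k where k: "k analytic_on {0}" "\<And>x. h x = 1 + x * (0 + x * k x)"
    using analytic_taylor_2[OF h] unfolding h0 dh by blast
  have "expands (K + Suc 0) (half_binom 0)"
  proof (rule expands_of_difference[OF tendsto_half_binom_0])
    show "expands K (\<lambda>n. half_binom 0 n * k (1 / of_nat n))"
      by (intro expands_mult Suc expands_analytic k)
    show "\<forall>\<^sub>F n in sequentially. half_binom 0 (Suc n) - half_binom 0 n =
        half_binom 0 n * k (1 / of_nat n) / of_nat n ^ (0 + 2)"
      using eventually_gt_at_top[of 0]
    proof eventually_elim
      case (elim n)
      have "half_binom 0 (Suc n) = half_binom 0 n * h (1 / of_nat n)"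
        using half_binom_0_Suc[OF elim] by (simp only: h_def)
      then show ?case by (simp add: k(2) algebra_simps power2_eq_square)
    qed
  qed
  then show ?case by simp
qed

text \<open>Absorption identity for \<open>gchoose\<close> with upper entry
  \<open>i + 3 / 2\<close>; the bound on \<open>n\<close> avoids a zero denominator. As a function
  of \<open>1 / n\<close> the factor is analytic and vanishes at \<open>0\<close>, so each further
  power of \<open>1 - z\<close> costs an order.\<close>

lemma half_binom_Suc:
  assumes "n > i + 1"
  shows "half_binom (Suc i) n = half_binom i n *
     ((of_nat i + 3 / 2) * (1 / of_nat n) / ((of_nat i + 3 / 2) * (1 / of_nat n) - 1))"
proof -
  define a :: complex where "a = of_nat i + 3 / 2"
  have "Re (of_nat n - a) > 0"
    using assms by (simp add: a_def) 
  then have nz: "a - of_nat n \<noteq> 0" by (metis minus_diff_eq neg_0_equal_iff_equal less_irrefl zero_complex.sel(1))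
  have "(a - of_nat n) * (a gchoose n) = a * ((a - 1) gchoose n)"
    by (rule gbinomial_absorb_comp)
  then have "(a gchoose n) = a / (a - of_nat n) * ((a - 1) gchoose n)"
    using nz by (simp add: field_simps)
  moreover have "a / (a - of_nat n) = a * (1 / of_nat n) / (a * (1 / of_nat n) - 1)"
    using nz assms by (simp add: field_simps)
  moreover have "of_nat (Suc i) + 1 / 2 = a" "of_nat i + 1 / 2 = a - 1" by (simp_all add: a_def)
  ultimately have "((of_nat (Suc i) + 1 / 2) gchoose n) =
     a * (1 / of_nat n) / (a * (1 / of_nat n) - 1) * ((of_nat i + 1 / 2) gchoose n)"
    by (simp only:)
  then show ?thesis
    unfolding half_binom_def a_def by (simp only: mult_ac)
qed

lemma half_binom_step:
  shows "expands K (half_binom i) \<Longrightarrow> expands K (half_binom (Suc i))"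
    and "(half_binom i) \<longlonglongrightarrow> L \<Longrightarrow> half_binom (Suc i) \<longlonglongrightarrow> 0"
proof -
  define h :: "complex \<Rightarrow> complex" where "h = (\<lambda>x. (of_nat i + 3 / 2) * x / ((of_nat i + 3 / 2) * x - 1))"
  have h: "h analytic_on {0}" unfolding h_def by (intro analytic_intros) auto
  have ev: "\<forall>\<^sub>F n in sequentially. half_binom i n * h (1 / of_nat n) = half_binom (Suc i) n"
    using eventually_gt_at_top[of "i + 1"] by eventually_elim (simp only: half_binom_Suc h_def)
  show "expands K (half_binom (Suc i))" if "expands K (half_binom i)"
    by (rule expands_cong[OF _ ev]) (intro expands_mult that expands_analytic h)
  show "half_binom (Suc i) \<longlonglongrightarrow> 0" if "half_binom i \<longlonglongrightarrow> L"
  proof -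
    have "(\<lambda>n. h (1 / of_nat n)) \<longlonglongrightarrow> h 0"
      by (rule isCont_tendsto_compose[OF _ inverse_nat_tendsto_0])
        (use h analytic_at_imp_isCont in blast)
    from tendsto_mult[OF that this] have "(\<lambda>n. half_binom i n * h (1 / of_nat n)) \<longlonglongrightarrow> 0"
      by (simp add: h_def)
    then show ?thesis using ev by (rule Lim_transform_eventually)
  qed
qed

lemma expands_half_binom: "expands K (half_binom i)"
  by (induction i) (auto intro: expands_half_binom_0 half_binom_step)

lemma convergent_half_binom: "\<exists>L. half_binom i \<longlonglongrightarrow> L"
  by (induction i) (use tendsto_half_binom_0 half_binom_step(2) in blast)+

lemma tendsto_half_binom_Suc: "half_binom (Suc i) \<longlonglongrightarrow> 0"
  using convergent_half_binom half_binom_step(2) by blast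

section \<open>Darboux's method for a square-root singularity\<close>

text \<open>A finite subcover of \<open>K\<close>. Local bounds are required at every point of
  \<open>K\<close>, boundary points of \<open>D\<close> included, but they concern values on
  \<open>D\<close> alone.\<close>

lemma bounded_image_of_locally_bounded:
  fixes f :: "'a::metric_space \<Rightarrow> 'b::metric_space"
  assumes "compact K" "D \<subseteq> K" "\<And>x. x \<in> K \<Longrightarrow> \<exists>U. open U \<and> x \<in> U \<and> bounded (f ` (U \<inter> D))"
  shows "bounded (f ` D)"
proof -
  obtain U where U: "\<And>x. x \<in> K \<Longrightarrow> open (U x) \<and> x \<in> U x \<and> bounded (f ` (U x \<inter> D))"
    using assms(3) by metis
  obtain T where T: "T \<subseteq> K" "finite T" "K \<subseteq> (\<Union>x\<in>T. U x)"
    using compactE_image[OF assms(1), of K U] U by blast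
  have "bounded (\<Union>x\<in>T. f ` (U x \<inter> D))"
    using T U by (intro bounded_UN) auto
  moreover have "f ` D \<subseteq> (\<Union>x\<in>T. f ` (U x \<inter> D))" using T assms(2) by blast
  ultimately show ?thesis by (rule bounded_subset)
qed

text \<open>Cauchy's inequality on circles of radius \<open>r < 1\<close>, followed by
  \<open>r \<rightarrow> 1\<close>, since nothing is known on the unit circle itself.\<close>

lemma fps_expansion_coeff_bound:
  assumes "f holomorphic_on ball 0 1" "\<And>z. z \<in> ball 0 1 \<Longrightarrow> norm (f z) \<le> B"
  shows "norm (fps_nth (fps_expansion f 0) n) \<le> B"
proof -
  define c where "c = fps_nth (fps_expansion f 0) n"
  have "norm c * r ^ n \<le> B" if r: "0 < r" "r < 1" for r :: real
  proof -
    have "norm ((deriv ^^ n) f 0) \<le> fact n * B / r ^ n"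
    proof (rule Cauchy_inequality)
      show "f holomorphic_on ball 0 r" "continuous_on (cball 0 r) f"
        using assms(1) r by (auto intro!: holomorphic_on_imp_continuous_on elim!: holomorphic_on_subset)
    qed (use r assms(2) in auto)
    then show ?thesis using r by (simp add: c_def fps_expansion_def norm_divide field_simps)
  qed
  then have ev: "\<forall>\<^sub>F r in at_left (1::real). norm c * r ^ n \<le> B"
    using eventually_at_left_real[of 0 "1::real"] by (simp add: eventually_mono)
  have "((\<lambda>r::real. norm c * r ^ n) \<longlongrightarrow> norm c * 1 ^ n) (at_left 1)"
    by (intro tendsto_intros)
  from tendsto_upperbound[OF this ev] show ?thesis by (simp add: c_def)
qed

lemma norm_csqrt_less:
  assumes "norm (z - 1) < e\<^sup>2" "0 < e"
  shows "norm (csqrt (1 - z)) < e"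
proof -
  have "(norm (csqrt (1 - z)))\<^sup>2 = norm (1 - z)"
    by (simp flip: norm_power)
  then show ?thesis using assms by (metis norm_minus_commute power2_less_imp_less less_imp_le)
qed

lemma Re_less_1:
  assumes "norm z \<le> 1" "z \<noteq> 1"
  shows "Re z < 1"
proof (rule ccontr)
  assume "\<not> Re z < 1"
  moreover have "Re z \<le> norm z" by (rule complex_Re_le_cmod)
  ultimately have r: "Re z = 1" using assms by simp
  have "(Re z)\<^sup>2 + (Im z)\<^sup>2 \<le> 1" using assms(1) by (simp add: cmod_def)
  then have "Im z = 0" by (simp add: r)
  with r assms(2) show False by (simp add: complex_eq_iff)
qed

lemma one_minus_notin_nonpos_Reals:
  assumes "Re z < 1"
  shows "1 - z \<notin> \<real>\<^sub>\<le>\<^sub>0"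
  using assms by (auto simp: complex_nonpos_Reals_iff)

lemma has_field_derivative_csqrt_one_minus:
  assumes "Re z < 1"
  shows "((\<lambda>z. csqrt (1 - z)) has_field_derivative - 1 / (2 * csqrt (1 - z))) (at z)"
  by (rule has_field_derivative_csqrt')
     (use one_minus_notin_nonpos_Reals[OF assms] in \<open>auto intro!: derivative_eq_intros\<close>)

text \<open>For \<open>s = csqrt (1 - z)\<close> one has \<open>ds / dz = - 1 / (2 * s)\<close>, so
  a derivative in \<open>z\<close> turns \<open>s ^ (2 * N + 2) * Q s\<close> into
  \<open>s ^ (2 * N)\<close> times an analytic function of \<open>s\<close>. After \<open>N\<close>
  derivatives, boundedness on the disc is enough, and each derivative has multiplied the
  coefficients by their index.\<close>

lemma darboux_bound:
  assumes "f holomorphic_on ball 0 1"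
    and "\<And>\<zeta>. \<zeta> \<in> sphere 0 1 - {1} \<Longrightarrow>
       \<exists>U F. open U \<and> \<zeta> \<in> U \<and> F holomorphic_on U \<and> (\<forall>z\<in>U \<inter> ball 0 1. F z = f z)"
    and "Q analytic_on {0}"
    and "\<forall>\<^sub>F z in at 1 within ball 0 1. f z = csqrt (1 - z) ^ (2 * N) * Q (csqrt (1 - z))"
  shows "(\<lambda>n. fps_nth (fps_expansion f 0) n) \<in> O(\<lambda>n. 1 / of_nat n ^ N)"
  using assms
proof (induction N arbitrary: f Q)
  case 0
  have "bounded (f ` ball 0 1)"
  proof (rule bounded_image_of_locally_bounded[of "cball 0 1"])
    fix \<zeta> :: complex assume \<zeta>: "\<zeta> \<in> cball 0 1"
    have bdd: "\<exists>U. open U \<and> \<zeta> \<in> U \<and> bounded (f ` (U \<inter> ball 0 1))"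
      if "open V" "\<zeta> \<in> V" "F holomorphic_on V" "\<forall>z\<in>V \<inter> ball 0 1. F z = f z" for V F
    proof -
      obtain e where e: "e > 0" "cball \<zeta> e \<subseteq> V" using \<open>open V\<close> \<open>\<zeta> \<in> V\<close> open_contains_cball by blast
      have "bounded (F ` cball \<zeta> e)"
        using that(3) e by (intro compact_imp_bounded compact_continuous_image)
          (auto intro: holomorphic_on_imp_continuous_on holomorphic_on_subset)
      moreover have "f ` (ball \<zeta> e \<inter> ball 0 1) \<subseteq> F ` cball \<zeta> e"
      proof
        fix w assume "w \<in> f ` (ball \<zeta> e \<inter> ball 0 1)"
        then obtain z where z: "z \<in> ball \<zeta> e" "z \<in> ball 0 1" "w = f z" by blast
        then have "z \<in> cball \<zeta> e" using ball_subset_cball by blast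
        moreover from this have "z \<in> V" using e(2) by blast
        then have "w = F z" using z(2,3) that(4) by (metis IntI)
        ultimately show "w \<in> F ` cball \<zeta> e" by blast
      qed
      ultimately have "bounded (f ` (ball \<zeta> e \<inter> ball 0 1))" by (rule bounded_subset)
      then show ?thesis using e by (intro exI[of _ "ball \<zeta> e"]) auto
    qed
    consider "\<zeta> \<in> ball 0 1" | "\<zeta> \<in> sphere 0 1 - {1}" | "\<zeta> = 1" using \<zeta> by fastforce
    then show "\<exists>U. open U \<and> \<zeta> \<in> U \<and> bounded (f ` (U \<inter> ball 0 1))"
    proof cases
      case 1
      then show ?thesis using bdd[of "ball 0 1" f] 0(1) by auto
    next
      case 2
      then show ?thesis using bdd 0(2) by meson
    next
      \<comment> \<open>At \<open>1\<close> the bound comes from \<open>Q\<close>: radius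
        \<open>e^2\<close> in \<open>z\<close> becomes radius \<open>e\<close> for
        \<open>csqrt (1 - z)\<close>.\<close>
      case 3
      obtain d where d: "d > 0" "\<And>z. z \<in> ball 0 1 \<Longrightarrow> z \<noteq> 1 \<Longrightarrow> dist z 1 < d \<Longrightarrow> f z = Q (csqrt (1 - z))"
        using 0(4) by (auto simp: eventually_at)
      obtain S where "open S" "0 \<in> S" "Q holomorphic_on S"
        using 0(3) analytic_at by blast
      then obtain e where e: "e > 0" "Q holomorphic_on cball 0 e"
        by (meson holomorphic_on_subset open_contains_cball)
      have "bounded (Q ` cball 0 e)"
        using e by (intro compact_imp_bounded compact_continuous_image)
          (auto intro: holomorphic_on_imp_continuous_on)
      moreover have "f ` (ball 1 (min d (e\<^sup>2)) \<inter> ball 0 1) \<subseteq> Q ` cball 0 e"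
      proof
        fix w assume "w \<in> f ` (ball 1 (min d (e\<^sup>2)) \<inter> ball 0 1)"
        then obtain z where "z \<in> ball 1 (min d (e\<^sup>2)) \<inter> ball 0 1" and w: "w = f z" by blast
        then have z: "norm (z - 1) < d" "norm (z - 1) < e\<^sup>2" "z \<in> ball 0 1"
          by (auto simp: dist_norm norm_minus_commute)
        then have "z \<noteq> 1" by auto
        with z d w have "w = Q (csqrt (1 - z))" by (simp add: dist_norm)
        moreover have "csqrt (1 - z) \<in> cball 0 e" using norm_csqrt_less[OF z(2) e(1)] by simp
        ultimately show "w \<in> Q ` cball 0 e" by blast
      qed
      ultimately have "bounded (f ` (ball 1 (min d (e\<^sup>2)) \<inter> ball 0 1))" by (rule bounded_subset)
      then show ?thesis using d e 3 by (intro exI[of _ "ball 1 (min d (e\<^sup>2))"]) auto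
    qed
  qed auto
  then obtain B where B: "\<And>z. z \<in> ball 0 1 \<Longrightarrow> norm (f z) \<le> B"
    by (metis bounded_iff imageI)
  from fps_expansion_coeff_bound[OF 0(1) this] show ?case
    by (intro bigoI[where c = B]) (auto simp del: mem_ball)
next
  case (Suc N)
  have "(\<lambda>n. fps_nth (fps_expansion (deriv f) 0) n) \<in> O(\<lambda>n. 1 / of_nat n ^ N)"
  proof (rule Suc.IH)
    show "deriv f holomorphic_on ball 0 1"
      by (intro holomorphic_deriv Suc.prems) auto
    show "\<exists>U F. open U \<and> \<zeta> \<in> U \<and> F holomorphic_on U \<and> (\<forall>z\<in>U \<inter> ball 0 1. F z = deriv f z)"
      if \<zeta>: "\<zeta> \<in> sphere 0 1 - {1}" for \<zeta>
    proof -
      obtain U F where U: "open U" "\<zeta> \<in> U" "F holomorphic_on U" "\<forall>z\<in>U \<inter> ball 0 1. F z = f z"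
        using Suc.prems(2)[OF \<zeta>] by blast
      have "deriv F z = deriv f z" if "z \<in> U \<inter> ball 0 1" for z
      proof (rule deriv_cong_ev)
        show "\<forall>\<^sub>F x in nhds z. F x = f x"
          using eventually_nhds_in_open[OF open_Int[OF U(1) open_ball] that]
          by eventually_elim (use U(4) in blast)
      qed simp
      then show ?thesis using U by (intro exI[of _ U] exI[of _ "deriv F"]) (auto intro: holomorphic_deriv)
    qed
    define m where "m = 2 * N"
    \<comment> \<open>The \<open>s\<close>-derivative of \<open>s ^ (m + 2) * Q s\<close>,
      multiplied by \<open>- 1 / (2 * s)\<close> and divided by \<open>s ^ m\<close>.\<close>
    define Q' where "Q' = (\<lambda>x. - (of_nat (m + 2) * Q x + x * deriv Q x) / 2)"
    show "Q' analytic_on {0}" unfolding Q'_def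
      by (intro analytic_intros analytic_deriv Suc.prems) auto
    obtain d where d: "d > 0" "\<And>z. z \<in> ball 0 1 \<Longrightarrow> z \<noteq> 1 \<Longrightarrow> dist z 1 < d \<Longrightarrow>
         f z = csqrt (1 - z) ^ (m + 2) * Q (csqrt (1 - z))"
      using Suc.prems(4) by (auto simp: eventually_at m_def)
    obtain S where "open S" "0 \<in> S" "Q holomorphic_on S"
      using Suc.prems(3) analytic_at by blast
    then obtain e where e: "e > 0" "Q holomorphic_on ball 0 e"
      by (meson holomorphic_on_subset open_contains_ball)
    have "deriv f z = csqrt (1 - z) ^ m * Q' (csqrt (1 - z))"
      if z: "z \<in> ball 0 1" "norm (z - 1) < min d (e\<^sup>2)" for z
    proof -
      define s where "s = csqrt (1 - z)"
      have Re: "Re z < 1" using z by (intro Re_less_1) auto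
      then have s: "s \<noteq> 0" by (auto simp: s_def)
      have "norm s < e" unfolding s_def by (rule norm_csqrt_less) (use z e in auto)
      then have dQ: "(Q has_field_derivative deriv Q s) (at s)"
        using e by (intro holomorphic_derivI[of _ "ball 0 e"]) auto
      have "((\<lambda>x. x ^ (m + 2)) has_field_derivative of_nat (m + 2) * s ^ (m + 1)) (at s)"
        using DERIV_power[OF DERIV_ident, where n = "m + 2" and x = s] by simp
      from DERIV_mult[OF this dQ] have "((\<lambda>x. x ^ (m + 2) * Q x) has_field_derivative
          of_nat (m + 2) * s ^ (m + 1) * Q s + deriv Q s * s ^ (m + 2)) (at s)" .
      from DERIV_chain2[OF this[unfolded s_def] has_field_derivative_csqrt_one_minus[OF Re]]
      have "((\<lambda>z. csqrt (1 - z) ^ (m + 2) * Q (csqrt (1 - z))) has_field_derivative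
          (of_nat (m + 2) * s ^ (m + 1) * Q s + deriv Q s * s ^ (m + 2)) * (- 1 / (2 * s))) (at z)"
        by (simp only: s_def)
      also have "(of_nat (m + 2) * s ^ (m + 1) * Q s + deriv Q s * s ^ (m + 2)) * (- 1 / (2 * s)) = s ^ m * Q' s"
        using s by (simp add: Q'_def field_simps)
      finally have D: "((\<lambda>z. csqrt (1 - z) ^ (m + 2) * Q (csqrt (1 - z))) has_field_derivative s ^ m * Q' s) (at z)" .
      have "deriv f z = deriv (\<lambda>z. csqrt (1 - z) ^ (m + 2) * Q (csqrt (1 - z))) z"
      proof (rule deriv_cong_ev)
        have "\<forall>\<^sub>F x in nhds z. x \<in> ball 0 1 \<inter> ball 1 d"
          using z by (intro eventually_nhds_in_open) (auto simp: dist_norm norm_minus_commute)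
        then show "\<forall>\<^sub>F x in nhds z. f x = csqrt (1 - x) ^ (m + 2) * Q (csqrt (1 - x))"
        proof eventually_elim
          case (elim x)
          then have "x \<noteq> 1" by auto
          with elim d show ?case by (auto simp: dist_commute)
        qed
      qed simp
      with DERIV_imp_deriv[OF D] show ?thesis by (simp add: s_def)
    qed
    then show "\<forall>\<^sub>F z in at 1 within ball 0 1. deriv f z = csqrt (1 - z) ^ (2 * N) * Q' (csqrt (1 - z))"
      unfolding eventually_at m_def using d e
      by (intro exI[of _ "min d (e\<^sup>2)"]) (auto simp: dist_norm)
  qed
  moreover have coeff: "fps_nth (fps_expansion (deriv f) 0) n = of_nat (Suc n) * fps_nth (fps_expansion f 0) (Suc n)" for n
    by (simp add: fps_expansion_def funpow_Suc_right divide_simps del: funpow.simps of_nat_Suc)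
  ultimately obtain C where C: "C > 0" "\<forall>\<^sub>F n in sequentially.
      norm (of_nat (Suc n) * fps_nth (fps_expansion f 0) (Suc n)) \<le> C * norm (1 / of_nat n ^ N :: complex)"
    using landau_o.bigE by (auto elim!: landau_o.bigE)
  have "\<forall>\<^sub>F n in sequentially.
      norm (fps_nth (fps_expansion f 0) (Suc n)) \<le> C * 2 ^ N * norm (1 / of_nat (Suc n) ^ Suc N :: complex)"
    using C(2) eventually_gt_at_top[of 0]
  proof eventually_elim
    case (elim n)
    define c where "c = norm (fps_nth (fps_expansion f 0) (Suc n))"
    have "real (Suc n) * c \<le> C * (1 / real n ^ N)"
      using elim(1) by (simp only: norm_mult norm_divide norm_power norm_of_nat norm_one c_def)
    \<comment> \<open>Coefficient \<open>n\<close> of the derivative belongs to index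
      \<open>n + 1\<close> of \<open>f\<close>; adjusting the bound to that index costs at most
      \<open>2 ^ N\<close>.\<close>
    also have "1 / real n ^ N \<le> 2 ^ N / real (Suc n) ^ N"
    proof -
      have "real (Suc n) ^ N \<le> (2 * real n) ^ N" using elim(2) by (intro power_mono) auto
      then show ?thesis using elim(2) by (simp add: divide_simps power_mult_distrib mult_ac del: of_nat_Suc)
    qed
    finally have "real (Suc n) * c \<le> C * (2 ^ N / real (Suc n) ^ N)" using C(1) by simp
    then have "c \<le> C * (2 ^ N / real (Suc n) ^ N) / real (Suc n)"
      by (simp add: pos_le_divide_eq mult.commute del: of_nat_Suc)
    then show ?case by (simp add: c_def norm_divide norm_mult norm_power mult_ac del: of_nat_Suc)
  qed
  then have "\<forall>\<^sub>F n in sequentially.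
      norm (fps_nth (fps_expansion f 0) n) \<le> C * 2 ^ N * norm (1 / of_nat n ^ Suc N :: complex)"
    by (subst (asm) eventually_sequentially_Suc)
  then show ?case by (rule bigoI)
qed

text \<open>Terms are peeled off in pairs because \<open>x\<close> will be
  \<open>csqrt (1 - z)\<close>: its even powers are polynomials in \<open>z\<close>, its odd ones
  half-integer powers of \<open>1 - z\<close>. The value \<open>\<beta> 0\<close> is recorded as it
  becomes the leading coefficient.\<close>

lemma analytic_taylor_pairs:
  fixes h :: "complex \<Rightarrow> complex"
  assumes "h analytic_on {0}"
  shows "\<exists>\<alpha> \<beta> Q. Q analytic_on {0} \<and> (N > 0 \<longrightarrow> \<beta> 0 = deriv h 0) \<and>
    (\<forall>x. h x = (\<Sum>i<N. (\<alpha> i + \<beta> i * x) * (x\<^sup>2) ^ i) + x ^ (2 * N) * Q x)"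
  using assms
proof (induction N arbitrary: h)
  case 0
  then show ?case by (intro exI[of _ "\<lambda>_. 0"] exI[of _ h]) auto
next
  case (Suc N)
  obtain k where k: "k analytic_on {0}" "\<And>x. h x = h 0 + x * (deriv h 0 + x * k x)"
    using analytic_taylor_2[OF Suc.prems] by blast
  obtain \<alpha> \<beta> Q where Q: "Q analytic_on {0}"
    "\<And>x. k x = (\<Sum>i<N. (\<alpha> i + \<beta> i * x) * (x\<^sup>2) ^ i) + x ^ (2 * N) * Q x"
    using Suc.IH[OF k(1)] by blast
  define \<alpha>' where "\<alpha>' = case_nat (h 0) \<alpha>"
  define \<beta>' where "\<beta>' = case_nat (deriv h 0) \<beta>"
  have "h x = (\<Sum>i<Suc N. (\<alpha>' i + \<beta>' i * x) * (x\<^sup>2) ^ i) + x ^ (2 * Suc N) * Q x" for x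
  proof -
    have "(\<Sum>i<Suc N. (\<alpha>' i + \<beta>' i * x) * (x\<^sup>2) ^ i) =
        h 0 + deriv h 0 * x + x\<^sup>2 * (\<Sum>i<N. (\<alpha> i + \<beta> i * x) * (x\<^sup>2) ^ i)"
      unfolding sum.lessThan_Suc_shift by (simp add: \<alpha>'_def \<beta>'_def sum_distrib_left mult_ac)
    moreover have "h x = h 0 + deriv h 0 * x + x\<^sup>2 * ((\<Sum>i<N. (\<alpha> i + \<beta> i * x) * (x\<^sup>2) ^ i) + x ^ (2 * N) * Q x)"
      using k(2)[of x] unfolding Q(2)[symmetric] by (simp add: algebra_simps power2_eq_square)
    ultimately show ?thesis by (simp add: algebra_simps power2_eq_square)
  qed
  moreover have "\<beta>' 0 = deriv h 0" by (simp add: \<beta>'_def)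
  ultimately show ?case using Q(1) by blast
qed

section \<open>Binomial series and removal of the singular terms\<close>

lemma has_fps_expansion_one_minus_powr:
  "(\<lambda>z. (1 - z) powr (c :: complex)) has_fps_expansion Abs_fps (\<lambda>n. (-1) ^ n * (c gchoose n))"
proof -
  have "(\<lambda>z. - 1 * z :: complex) has_fps_expansion fps_const (-1) * fps_X"
    by (intro fps_expansion_intros)
  from has_fps_expansion_compose[OF has_fps_expansion_binomial_complex[of c] this]
  show ?thesis by (simp add: o_def fps_compose_linear)
qed

lemma csqrt_mult_power_eq_powr:
  assumes "z \<noteq> 0"
  shows "csqrt z * z ^ i = z powr (of_nat i + 1 / 2)" "z ^ i = z powr of_nat i"
  using assms by (simp_all add: csqrt_conv_powr powr_add powr_nat mult.commute)

text \<open>On the half plane \<open>Re z < 1\<close> the argument \<open>1 - z\<close> avoids the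
  branch cut. It contains the closed unit disc except \<open>1\<close>, so subtracting
  \<open>P\<close> preserves continuation across the rest of the circle.\<close>

lemma darboux_half_integer_sum:
  defines "P \<equiv> \<lambda>\<alpha> \<beta> N z. \<Sum>i<N. (\<alpha> i + \<beta> i * csqrt (1 - z)) * (1 - z) ^ i"
  shows "P \<alpha> \<beta> N has_fps_expansion
    Abs_fps (\<lambda>n. (-1) ^ n * (\<Sum>i<N. \<alpha> i * (of_nat i gchoose n) + \<beta> i * ((of_nat i + 1 / 2) gchoose n)))"
    and "P \<alpha> \<beta> N holomorphic_on {z. Re z < 1}"
proof -
  have f_exp: "(\<lambda>z. \<Sum>i<N. \<alpha> i * (1 - z) powr of_nat i + \<beta> i * (1 - z) powr (of_nat i + 1 / 2)) has_fps_expansion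
    (\<Sum>i<N. fps_const (\<alpha> i) * Abs_fps (\<lambda>n. (-1) ^ n * (of_nat i gchoose n)) +
      fps_const (\<beta> i) * Abs_fps (\<lambda>n. (-1) ^ n * ((of_nat i + 1 / 2) gchoose n)))" (is "?f has_fps_expansion ?F")
    by (intro fps_expansion_intros has_fps_expansion_one_minus_powr)
  have F_eq: "?F = Abs_fps (\<lambda>n. (-1) ^ n * (\<Sum>i<N. \<alpha> i * (of_nat i gchoose n) + \<beta> i * ((of_nat i + 1 / 2) gchoose n)))"
    by (rule fps_ext) (simp add: fps_sum_nth sum_distrib_left algebra_simps)
  have "\<forall>\<^sub>F z in nhds 0. ?f z = P \<alpha> \<beta> N z"
  proof -
    have "\<forall>\<^sub>F z in nhds (0::complex). z \<in> ball 0 1" by (intro eventually_nhds_in_open) auto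
    then show ?thesis
    proof eventually_elim
      case (elim z)
      then have "1 - z \<noteq> 0" by auto
      then show ?case unfolding P_def
        by (intro sum.cong refl) (simp add: csqrt_mult_power_eq_powr[symmetric] algebra_simps)
    qed
  qed
  from has_fps_expansion_cong[THEN iffD1, OF this F_eq f_exp]
  show "P \<alpha> \<beta> N has_fps_expansion
    Abs_fps (\<lambda>n. (-1) ^ n * (\<Sum>i<N. \<alpha> i * (of_nat i gchoose n) + \<beta> i * ((of_nat i + 1 / 2) gchoose n)))" .
  show "P \<alpha> \<beta> N holomorphic_on {z. Re z < 1}"
    unfolding P_def by (intro holomorphic_intros) (auto simp: one_minus_notin_nonpos_Reals)
qed

lemma nat_powr_three_halves_bigo:
  assumes "f \<in> O(\<lambda>n. 1 / of_nat n ^ (K + 2) :: complex)"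
  shows "(\<lambda>n. of_real (real n powr (3 / 2)) * f n) \<in> O(\<lambda>n. 1 / of_nat n ^ K)"
proof -
  have "(\<lambda>n. of_real (real n powr (3 / 2))) \<in> O(\<lambda>n. of_nat n ^ 2 :: complex)"
  proof (rule bigoI[where c = 1], use eventually_gt_at_top[of 0] in eventually_elim)
    fix n :: nat assume "n > 0"
    then have "real n powr (3 / 2) \<le> real n powr 2" by (intro powr_mono) auto
    with \<open>n > 0\<close> show "norm (of_real (real n powr (3 / 2)) :: complex) \<le> 1 * norm (of_nat n ^ 2 :: complex)"
      by (simp add: norm_power)
  qed
  from landau_o.big.mult[OF this assms]
  have "(\<lambda>n. of_real (real n powr (3 / 2)) * f n) \<in> O(\<lambda>n. of_nat n ^ 2 * (1 / of_nat n ^ (K + 2)))" .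
  also have "(\<lambda>n. of_nat n ^ 2 * (1 / of_nat n ^ (K + 2))) \<in> O(\<lambda>n. 1 / of_nat n ^ K :: complex)"
    by (rule bigoI[where c = 1], use eventually_gt_at_top[of 0] in eventually_elim) (simp add: power_add power2_eq_square)
  finally show ?thesis .
qed

lemma darboux_square_root:
  assumes hol: "f holomorphic_on ball 0 1"
    and ext: "\<And>\<zeta>. \<zeta> \<in> sphere 0 1 - {1} \<Longrightarrow>
       \<exists>U F. open U \<and> \<zeta> \<in> U \<and> F holomorphic_on U \<and> (\<forall>z\<in>U \<inter> ball 0 1. F z = f z)"
    and G: "G analytic_on {0}"
    and near: "\<forall>\<^sub>F z in at 1 within ball 0 1. f z = G (csqrt (1 - z))"
  defines "w \<equiv> \<lambda>n. of_real (real n powr (3 / 2)) * fps_nth (fps_expansion f 0) n"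
  shows "expands K w" and "w \<longlonglongrightarrow> deriv G 0 * inverse (Gamma (- (1 / 2)))"
proof -
  have "\<exists>e \<beta> N. e \<in> O(\<lambda>n. 1 / of_nat n ^ K) \<and> N > 0 \<and> \<beta> 0 = deriv G 0 \<and>
      (\<forall>\<^sub>F n in sequentially. (\<Sum>i<N. \<beta> i * half_binom i n) + e n = w n)" for K
  proof -
    \<comment> \<open>Two extra orders pay for the factor \<open>n powr (3 / 2)\<close>, whose
      exponent is rounded up to \<open>2\<close>.\<close>
    define N where "N = K + 2"
    have "N > 0" by (simp add: N_def)
    obtain \<alpha> \<beta> Q where Q: "Q analytic_on {0}" "\<beta> 0 = deriv G 0"
      "\<And>x. G x = (\<Sum>i<N. (\<alpha> i + \<beta> i * x) * (x\<^sup>2) ^ i) + x ^ (2 * N) * Q x"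
      using analytic_taylor_pairs[OF G, of N] \<open>N > 0\<close> by blast
    define P where "P = (\<lambda>z. \<Sum>i<N. (\<alpha> i + \<beta> i * csqrt (1 - z)) * (1 - z) ^ i)"
    define g where "g = (\<lambda>z. f z - P z)"
    have P: "P has_fps_expansion
      Abs_fps (\<lambda>n. (-1) ^ n * (\<Sum>i<N. \<alpha> i * (of_nat i gchoose n) + \<beta> i * ((of_nat i + 1 / 2) gchoose n)))"
      "P holomorphic_on {z. Re z < 1}"
      unfolding P_def by (rule darboux_half_integer_sum)+
    have Re1: "ball 0 1 \<subseteq> {z::complex. Re z < 1}"
      by (auto intro!: Re_less_1)
    have f_exp: "f has_fps_expansion fps_expansion f 0"
      by (rule has_fps_expansion_fps_expansion[OF _ _ hol]) auto
    have g_hol: "g holomorphic_on ball 0 1"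
      unfolding g_def by (intro holomorphic_intros hol holomorphic_on_subset[OF P(2) Re1])
    have "g has_fps_expansion fps_expansion g 0"
      by (rule has_fps_expansion_fps_expansion[OF _ _ g_hol]) auto
    moreover have "g has_fps_expansion (fps_expansion f 0 - 
        Abs_fps (\<lambda>n. (-1) ^ n * (\<Sum>i<N. \<alpha> i * (of_nat i gchoose n) + \<beta> i * ((of_nat i + 1 / 2) gchoose n))))"
      unfolding g_def by (intro has_fps_expansion_diff f_exp P)
    ultimately have g_exp: "fps_expansion g 0 = fps_expansion f 0 - 
        Abs_fps (\<lambda>n. (-1) ^ n * (\<Sum>i<N. \<alpha> i * (of_nat i gchoose n) + \<beta> i * ((of_nat i + 1 / 2) gchoose n)))"
      by (rule fps_expansion_unique_complex)
    have "(\<lambda>n. fps_nth (fps_expansion g 0) n) \<in> O(\<lambda>n. 1 / of_nat n ^ N)"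
    proof (rule darboux_bound[OF g_hol _ Q(1)])
      fix \<zeta> :: complex assume \<zeta>: "\<zeta> \<in> sphere 0 1 - {1}"
      then obtain U F where U: "open U" "\<zeta> \<in> U" "F holomorphic_on U" "\<forall>z\<in>U \<inter> ball 0 1. F z = f z"
        using ext by blast
      have "Re \<zeta> < 1" using \<zeta> by (intro Re_less_1) auto
      moreover have "open {z::complex. Re z < 1}" by (rule open_halfspace_Re_lt)
      moreover have "(\<lambda>z. F z - P z) holomorphic_on U \<inter> {z. Re z < 1}"
        using U(3) P(2) by (intro holomorphic_intros) (auto elim: holomorphic_on_subset)
      ultimately show "\<exists>U F. open U \<and> \<zeta> \<in> U \<and> F holomorphic_on U \<and> (\<forall>z\<in>U \<inter> ball 0 1. F z = g z)"
        using U by (intro exI[of _ "U \<inter> {z. Re z < 1}"] exI[of _ "\<lambda>z. F z - P z"])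
          (auto simp: g_def open_Int)
    next
      show "\<forall>\<^sub>F z in at 1 within ball 0 1. g z = csqrt (1 - z) ^ (2 * N) * Q (csqrt (1 - z))"
        using near by eventually_elim (simp add: g_def P_def Q(3))
    qed
    then have e: "(\<lambda>n. of_real (real n powr (3 / 2)) * fps_nth (fps_expansion g 0) n) \<in> O(\<lambda>n. 1 / of_nat n ^ K)"
      unfolding N_def by (rule nat_powr_three_halves_bigo)
    have "\<forall>\<^sub>F n in sequentially. (\<Sum>i<N. \<beta> i * half_binom i n) +
        of_real (real n powr (3 / 2)) * fps_nth (fps_expansion g 0) n = w n"
      using eventually_ge_at_top[of N]
    proof eventually_elim
      case (elim n)
      \<comment> \<open>The integer powers of \<open>1 - z\<close> are polynomials of degree below
        \<open>N\<close> and drop out from index \<open>N\<close> on.\<close>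
      have "of_nat i gchoose n = (0::complex)" if "i < N" for i
        using that elim by (simp add: binomial_gbinomial[symmetric])
      then have "fps_nth (fps_expansion g 0) n = fps_nth (fps_expansion f 0) n - (-1) ^ n * (\<Sum>i<N. \<beta> i * ((of_nat i + 1 / 2) gchoose n))"
        by (simp add: g_exp)
      moreover have "(\<Sum>i<N. \<beta> i * half_binom i n) = of_real (real n powr (3 / 2)) *
          ((-1) ^ n * (\<Sum>i<N. \<beta> i * ((of_nat i + 1 / 2) gchoose n)))"
        by (simp add: half_binom_def sum_distrib_left mult_ac)
      ultimately show ?case
        by (simp add: w_def right_diff_distrib)
    qed
    with e Q(2) \<open>N > 0\<close> show ?thesis
      by (intro exI[of _ "\<lambda>n. of_real (real n powr (3 / 2)) * fps_nth (fps_expansion g 0) n"]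
          exI[of _ \<beta>] exI[of _ N] conjI)
  qed
  note main = this
  show "expands K w"
  proof -
    obtain e \<beta> N where e: "e \<in> O(\<lambda>n. 1 / of_nat n ^ K)"
      "\<forall>\<^sub>F n in sequentially. (\<Sum>i<N. \<beta> i * half_binom i n) + e n = w n" using main[of K] by blast
    show ?thesis
      by (rule expands_cong[OF _ e(2)])
        (intro expands_add expands_sum expands_cmult expands_half_binom expands_of_bigo e(1))
  qed
  show "w \<longlonglongrightarrow> deriv G 0 * inverse (Gamma (- (1 / 2)))"
  proof -
    obtain e \<beta> N where e: "e \<in> O(\<lambda>n. 1 / of_nat n ^ Suc 0)" "N > 0" "\<beta> 0 = deriv G 0"
      "\<forall>\<^sub>F n in sequentially. (\<Sum>i<N. \<beta> i * half_binom i n) + e n = w n" using main[of "Suc 0"] by blast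
    \<comment> \<open>The sequences with \<open>i > 0\<close> tend to \<open>0\<close>, so only
      \<open>\<beta> 0\<close> survives in the limit.\<close>
    define L where "L = (\<lambda>i::nat. if i = 0 then inverse (Gamma (- (1 / 2))) else 0 :: complex)"
    have L: "half_binom i \<longlonglongrightarrow> L i" for i
      by (cases i) (simp_all add: L_def tendsto_half_binom_0 tendsto_half_binom_Suc)
    have "(\<lambda>n. (\<Sum>i<N. \<beta> i * half_binom i n) + e n) \<longlonglongrightarrow> (\<Sum>i<N. \<beta> i * L i) + 0"
      by (intro tendsto_intros L bigo_inverse_power_imp_tendsto_0[OF e(1)])
    also have "(\<Sum>i<N. \<beta> i * L i) + 0 = deriv G 0 * inverse (Gamma (- (1 / 2)))"
      using e(2,3) by (simp add: L_def if_distrib cong: if_cong)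
    finally show ?thesis using e(4) by (rule Lim_transform_eventually)
  qed
qed

section \<open>Charts of a Riemann surface\<close>

lemma complex_chart_open_image:
  assumes "complex_chart U c" "open W" "W \<subseteq> U"
  shows "open (c ` W)"
proof -
  have "openin (top_of_set U) W"
    using assms by (simp add: openin_open_eq complex_chart_def)
  then have "openin (top_of_set (c ` U)) (c ` W)"
    using assms(1) homeomorphism_imp_open_map unfolding complex_chart_def by blast
  then show ?thesis using assms(1) by (simp add: openin_open_eq complex_chart_def)
qed

lemma complex_chart_inv_into [simp]:
  assumes "complex_chart U c" "q \<in> U"
  shows "inv_into U c (c q) = q"
  using assms unfolding complex_chart_def homeomorphism_def by blast

lemma complex_chart_continuous_on:
  assumes "complex_chart U c"
  shows "continuous_on U c"
  using assms unfolding complex_chart_def homeomorphism_def by blast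

lemma atlas_chart_at:
  assumes "riemann_surface \<A>"
  obtains V e where "(V, e) \<in> \<A>" "q \<in> V" "complex_chart V e" "open V"
proof -
  have "q \<in> (\<Union>(V, e)\<in>\<A>. V)" using assms unfolding riemann_surface_def by simp
  then obtain V e where "(V, e) \<in> \<A>" "q \<in> V" by blast
  moreover from this have "complex_chart V e"
    using assms unfolding riemann_surface_def by blast
  ultimately show thesis using that by (auto simp: complex_chart_def)
qed

lemma holomorphic_on_if_locally:
  assumes "\<And>z. z \<in> S \<Longrightarrow> \<exists>T. open T \<and> z \<in> T \<and> f holomorphic_on T"
  shows "f holomorphic_on S"
proof -
  have "f field_differentiable (at z within S)" if "z \<in> S" for z
    using assms[OF that] by (meson field_differentiable_at_within holomorphic_on_imp_differentiable_at)
  then show ?thesis by (simp add: holomorphic_on_def)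
qed

text \<open>\<open>holomorphic_map_on\<close> tests only members of the atlas, whereas
  \<open>c\<close> may be any compatible chart. Near each point the transition map to an atlas chart
  bridges the two.\<close>

lemma holomorphic_in_chart:
  assumes "riemann_surface \<A>" "holomorphic_chart \<A> U c"
    and f: "holomorphic_map_on \<A> plane_atlas S f" "open S"
  shows "(f \<circ> inv_into U c) holomorphic_on c ` (S \<inter> U)"
proof (rule holomorphic_on_if_locally)
  fix z assume "z \<in> c ` (S \<inter> U)"
  then obtain q where q: "q \<in> S" "q \<in> U" "z = c q" by blast
  obtain V e where V: "(V, e) \<in> \<A>" "q \<in> V" "complex_chart V e" "open V"
    using atlas_chart_at[OF assms(1)] by blast
  have U: "complex_chart U c" "open U" and comp: "charts_compatible U c V e"
    using assms(2) V(1) by (auto simp: holomorphic_chart_def complex_chart_def)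
  have "open (c ` (S \<inter> U \<inter> V))"
    using U V(4) f(2) by (intro complex_chart_open_image[of U]) auto
  moreover have "z \<in> c ` (S \<inter> U \<inter> V)" using q V(2) by blast
  moreover have "(f \<circ> inv_into U c) holomorphic_on c ` (S \<inter> U \<inter> V)"
  proof -
    have "((f \<circ> inv_into V e) \<circ> (e \<circ> inv_into U c)) holomorphic_on c ` (S \<inter> U \<inter> V)"
    proof (rule holomorphic_on_compose_gen)
      show "(e \<circ> inv_into U c) holomorphic_on c ` (S \<inter> U \<inter> V)"
        using comp unfolding charts_compatible_def by (auto elim: holomorphic_on_subset)
      show "(f \<circ> inv_into V e) holomorphic_on e ` (S \<inter> V)"
        using f(1) V(1) by (auto simp: holomorphic_map_on_def plane_atlas_def)
      show "(e \<circ> inv_into U c) ` (c ` (S \<inter> U \<inter> V)) \<subseteq> e ` (S \<inter> V)"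
        using U(1) by auto
    qed
    moreover have "((f \<circ> inv_into V e) \<circ> (e \<circ> inv_into U c)) x = (f \<circ> inv_into U c) x"
      if "x \<in> c ` (S \<inter> U \<inter> V)" for x
      using that U(1) V(3) by auto
    ultimately show ?thesis by (rule holomorphic_transform)
  qed
  ultimately show "\<exists>T. open T \<and> z \<in> T \<and> (f \<circ> inv_into U c) holomorphic_on T" by blast
qed

lemma holomorphic_compose_map:
  assumes "riemann_surface \<A>"
    and u: "holomorphic_map_on plane_atlas \<A> T u" "open T"
    and f: "holomorphic_map_on \<A> plane_atlas S f" "open S"
  shows "(f \<circ> u) holomorphic_on T \<inter> u -` S" "open (T \<inter> u -` S)"
proof -
  have cont: "continuous_on T u" using u(1) by (simp add: holomorphic_map_on_def)
  then show "open (T \<inter> u -` S)" by (rule continuous_open_preimage[OF _ u(2) f(2)])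
  show "(f \<circ> u) holomorphic_on T \<inter> u -` S"
  proof (rule holomorphic_on_if_locally)
    fix z assume z: "z \<in> T \<inter> u -` S"
    obtain V e where V: "(V, e) \<in> \<A>" "u z \<in> V" "complex_chart V e" "open V"
      using atlas_chart_at[OF assms(1)] by blast
    have "open (T \<inter> u -` (S \<inter> V))"
      using V(4) f(2) by (intro continuous_open_preimage[OF cont u(2)]) auto
    moreover have "z \<in> T \<inter> u -` (S \<inter> V)" using z V(2) by blast
    moreover have "(f \<circ> u) holomorphic_on T \<inter> u -` (S \<inter> V)"
    proof -
      have "((f \<circ> inv_into V e) \<circ> (e \<circ> u)) holomorphic_on T \<inter> u -` (S \<inter> V)"
      proof (rule holomorphic_on_compose_gen)
        have "(e \<circ> u) holomorphic_on T \<inter> u -` V"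
          using u(1) V(1) by (auto simp: holomorphic_map_on_def plane_atlas_def)
        then show "(e \<circ> u) holomorphic_on T \<inter> u -` (S \<inter> V)"
          by (auto elim: holomorphic_on_subset)
        show "(f \<circ> inv_into V e) holomorphic_on e ` (S \<inter> V)"
          using f(1) V(1) by (auto simp: holomorphic_map_on_def plane_atlas_def)
      qed auto
      moreover have "((f \<circ> inv_into V e) \<circ> (e \<circ> u)) x = (f \<circ> u) x"
        if "x \<in> T \<inter> u -` (S \<inter> V)" for x
        using that V(3) by auto
      ultimately show ?thesis by (rule holomorphic_transform)
    qed
    ultimately show "\<exists>T. open T \<and> z \<in> T \<and> (f \<circ> u) holomorphic_on T" by blast
  qed
qed

section \<open>Local form at the critical point\<close>

lemma square_normal_form:
  fixes h :: "complex \<Rightarrow> complex"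
  assumes h: "h analytic_on {0}" "deriv h 0 = 0" "deriv (deriv h) 0 \<noteq> 0"
  obtains \<psi> where "\<psi> analytic_on {0}" "\<psi> 0 = 0" "deriv \<psi> 0 \<noteq> 0" "\<And>w. h 0 - h w = (\<psi> w)\<^sup>2"
proof -
  obtain k where k: "k analytic_on {0}" "\<And>w. h w = h 0 + w * (0 + w * k w)"
    using analytic_taylor_2[OF h(1)] unfolding h(2) by blast
  obtain S where S: "open S" "0 \<in> S" "k holomorphic_on S" using k(1) analytic_at by blast
  \<comment> \<open>From \<open>h w = h 0 + w^2 * k w\<close>, the second derivative of
    \<open>h\<close> at \<open>0\<close> is \<open>2 * k 0\<close>.\<close>
  have k0: "k 0 \<noteq> 0"
  proof
    assume k0: "k 0 = 0"
    have dk: "(k has_field_derivative deriv k z) (at z)" if "z \<in> S" for z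
      using S that by (auto intro: holomorphic_derivI)
    have dh: "deriv h z = 2 * z * k z + z\<^sup>2 * deriv k z" if "z \<in> S" for z
    proof (rule DERIV_imp_deriv)
      have "((\<lambda>w. h 0 + w\<^sup>2 * k w) has_field_derivative 2 * z * k z + z\<^sup>2 * deriv k z) (at z)"
        by (auto intro!: derivative_eq_intros dk[OF that])
      moreover have "h = (\<lambda>w. h 0 + w\<^sup>2 * k w)"
        by (rule ext, subst k(2)) (simp add: power2_eq_square)
      ultimately show "(h has_field_derivative 2 * z * k z + z\<^sup>2 * deriv k z) (at z)" by metis
    qed
    have "deriv (deriv h) 0 = deriv (\<lambda>z. 2 * z * k z + z\<^sup>2 * deriv k z) 0"
    proof (rule deriv_cong_ev)
      show "\<forall>\<^sub>F z in nhds 0. deriv h z = 2 * z * k z + z\<^sup>2 * deriv k z"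
        using eventually_nhds_in_open[OF S(1,2)] by eventually_elim (rule dh)
    qed simp
    also have "\<dots> = 0"
    proof (rule DERIV_imp_deriv)
      have ddk: "(deriv k has_field_derivative deriv (deriv k) 0) (at 0)"
        using S by (auto intro: holomorphic_derivI holomorphic_deriv)
      show "((\<lambda>z. 2 * z * k z + z\<^sup>2 * deriv k z) has_field_derivative 0) (at 0)"
        by (auto intro!: derivative_eq_intros dk[OF S(2)] ddk simp: k0)
    qed
    finally show False using h(3) by simp
  qed
  \<comment> \<open>A square root of \<open>- k\<close>. Dividing by \<open>k 0\<close> puts the
    argument near \<open>1\<close>, off the branch cut wherever \<open>k 0\<close> lies; the
    constant factor compensates.\<close>
  define m where "m = (\<lambda>w. csqrt (k w / k 0) * csqrt (- k 0))"
  define \<psi> where "\<psi> = (\<lambda>w. w * m w)"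
  have m: "m analytic_on {0}" unfolding m_def
    using k0 by (intro analytic_intros k(1)) auto
  show thesis
  proof
    show "\<psi> analytic_on {0}" unfolding \<psi>_def by (intro analytic_intros m)
    show "\<psi> 0 = 0" by (simp add: \<psi>_def)
    have "(m has_field_derivative deriv m 0) (at 0)"
      using m analytic_derivI by blast
    then have "(\<psi> has_field_derivative m 0) (at 0)" unfolding \<psi>_def
      by (auto intro!: derivative_eq_intros)
    then have "deriv \<psi> 0 = m 0" by (rule DERIV_imp_deriv)
    also have "m 0 \<noteq> 0" using k0 by (simp add: m_def)
    finally show "deriv \<psi> 0 \<noteq> 0" .
    have "(m w)\<^sup>2 = - k w" for w
      using k0 by (simp add: m_def power_mult_distrib)
    then have "(\<psi> w)\<^sup>2 = w\<^sup>2 * - k w" for w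
      by (simp add: \<psi>_def power_mult_distrib)
    then show "h 0 - h w = (\<psi> w)\<^sup>2" for w
      using k(2)[of w] by (simp add: power2_eq_square)
  qed
qed

lemma analytic_local_inverse:
  fixes f :: "complex \<Rightarrow> complex"
  assumes "f analytic_on {a}" "deriv f a \<noteq> 0"
  obtains g where "g analytic_on {f a}" "deriv g (f a) \<noteq> 0" "\<forall>\<^sub>F z in nhds a. g (f z) = z"
proof -
  obtain S where S: "open S" "a \<in> S" "f holomorphic_on S" using assms(1) analytic_at by blast
  obtain r where r: "r > 0" "ball a r \<subseteq> S" "open (f ` ball a r)" "inj_on f (ball a r)"
    using has_complex_derivative_locally_invertible[OF S(3,2,1) assms(2)] by blast
  have "f holomorphic_on ball a r" using S(3) r(2) holomorphic_on_subset by blast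
  from holomorphic_has_inverse[OF this open_ball r(4)] obtain g where
    g: "g holomorphic_on f ` ball a r" "\<And>z. z \<in> ball a r \<Longrightarrow> deriv f z * deriv g (f z) = 1"
      "\<And>z. z \<in> ball a r \<Longrightarrow> g (f z) = z" by blast
  have a: "a \<in> ball a r" using r(1) by simp
  show thesis
  proof
    show "g analytic_on {f a}" using g(1) r(3) a analytic_at by blast
    show "deriv g (f a) \<noteq> 0" using g(2)[OF a] by auto
    show "\<forall>\<^sub>F z in nhds a. g (f z) = z"
      using eventually_nhds_in_open[OF open_ball a] by eventually_elim (rule g(3))
  qed
qed

text \<open>The quotient \<open>p / q\<close> is continuous with values in \<open>{1, -1}\<close>,
  hence constant on a connected set. Recording only \<open>\<sigma> \<noteq> 0\<close> suffices for
  the nonvanishing of the leading constant.\<close>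

lemma continuous_square_root_sign:
  fixes p q :: "'a::topological_space \<Rightarrow> complex"
  assumes "connected S" "continuous_on S p" "continuous_on S q"
    and sq: "\<And>z. z \<in> S \<Longrightarrow> (p z)\<^sup>2 = (q z)\<^sup>2" and nz: "\<And>z. z \<in> S \<Longrightarrow> q z \<noteq> 0"
  obtains \<sigma> where "\<sigma> \<noteq> 0" "\<And>z. z \<in> S \<Longrightarrow> p z = \<sigma> * q z"
proof -
  have "p z / q z \<in> {1, -1}" if "z \<in> S" for z
    using sq[OF that] nz[OF that] by (auto simp: power2_eq_iff)
  then have "(\<lambda>z. p z / q z) ` S \<subseteq> {1, -1}" by blast
  then have "finite ((\<lambda>z. p z / q z) ` S)" by (rule finite_subset) simp
  moreover have "continuous_on S (\<lambda>z. p z / q z)"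
    using assms(2,3) nz by (intro continuous_intros) auto
  ultimately have "(\<lambda>z. p z / q z) constant_on S"
    using assms(1) by (intro continuous_finite_range_constant)
  then obtain \<sigma> where \<sigma>: "\<And>z. z \<in> S \<Longrightarrow> p z / q z = \<sigma>" unfolding constant_on_def by blast
  show thesis
  proof (cases "S = {}")
    case False
    then obtain z where z: "z \<in> S" by blast
    have "\<sigma> \<noteq> 0" using \<sigma>[OF z] sq[OF z] nz[OF z] by auto
    moreover have "p z = \<sigma> * q z" if "z \<in> S" for z using \<sigma>[OF that] nz[OF that] by (simp add: field_simps)
    ultimately show thesis by (rule that)
  qed (use that[of 1] in auto)
qed

section \<open>Rotation symmetry and reduction to a single boundary point\<close>

lemma fps_nth_eq_0_of_rotation:
  fixes f :: "complex \<Rightarrow> complex"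
  assumes "R > 0" "d > 0" and f: "f has_fps_expansion a"
    and rot: "\<And>z. z \<in> ball 0 R \<Longrightarrow> f (cis (2 * pi / real d) * z) = cis (2 * pi * real r / real d) * f z"
    and n: "\<not> [n = r] (mod d)"
  shows "fps_nth a n = 0"
proof -
  define \<omega> where "\<omega> = cis (2 * pi / real d)"
  have \<omega>: "\<omega> ^ k = cis (2 * pi * real k / real d)" for k
    unfolding \<omega>_def Complex.DeMoivre by (rule arg_cong[where f = cis]) (simp add: mult_ac)
  have "(\<lambda>z. \<omega> * z) has_fps_expansion fps_const \<omega> * fps_X"
    by (intro fps_expansion_intros)
  from has_fps_expansion_compose[OF f this]
  have "(\<lambda>z. f (\<omega> * z)) has_fps_expansion Abs_fps (\<lambda>n. \<omega> ^ n * fps_nth a n)"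
    by (simp add: o_def fps_compose_linear)
  moreover have "(\<lambda>z. f (\<omega> * z)) has_fps_expansion fps_const (\<omega> ^ r) * a"
  proof -
    have "\<forall>\<^sub>F z in nhds 0. \<omega> ^ r * f z = f (\<omega> * z)"
    proof -
      have "\<forall>\<^sub>F z in nhds (0::complex). z \<in> ball 0 R"
        using \<open>R > 0\<close> by (intro eventually_nhds_in_open) auto
      then show ?thesis
        by eventually_elim (simp only: rot[folded \<omega>_def] \<omega>)
    qed
    from has_fps_expansion_cong[THEN iffD1, OF this refl] show ?thesis
      using f by (simp add: has_fps_expansion_cmult_left)
  qed
  ultimately have "Abs_fps (\<lambda>n. \<omega> ^ n * fps_nth a n) = fps_const (\<omega> ^ r) * a"
    by (rule fps_expansion_unique_complex)
  then have "fps_nth (Abs_fps (\<lambda>n. \<omega> ^ n * fps_nth a n)) n = fps_nth (fps_const (\<omega> ^ r) * a) n"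
    by simp
  then have "\<omega> ^ n = \<omega> ^ r \<or> fps_nth a n = 0" by auto
  \<comment> \<open>\<open>\<omega>\<close> is a primitive \<open>d\<close>-th root of unity, so its
    powers separate residues modulo \<open>d\<close>.\<close>
  moreover have "\<omega> ^ n \<noteq> \<omega> ^ r"
  proof
    assume "\<omega> ^ n = \<omega> ^ r"
    then have "exp (2 * of_real pi * \<i> * of_nat n / of_nat d) = exp (2 * of_real pi * \<i> * of_nat r / of_nat d)"
      by (simp add: \<omega> cis_conv_exp mult_ac)
    then have "n mod d = r mod d" using \<open>d > 0\<close> by (subst (asm) complex_root_unity_eq) auto
    with n show False by (simp add: cong_def)
  qed
  ultimately show ?thesis by simp
qed

text \<open>The principal branch, normalised to take the value \<open>R\<close> at \<open>1\<close>:
  among the \<open>d\<close> roots of \<open>R ^ d * y\<close> it picks the one tending to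
  \<open>R\<close> as \<open>y\<close> tends to \<open>1\<close>.\<close>

definition scaled_root :: "real \<Rightarrow> nat \<Rightarrow> complex \<Rightarrow> complex" where
  "scaled_root R d y = of_real R * exp (Ln y / of_nat d)"

lemma scaled_root_power:
  assumes "d > 0" "y \<noteq> 0"
  shows "scaled_root R d y ^ d = of_real R ^ d * y"
proof -
  have "exp (Ln y / of_nat d) ^ d = y"
    using assms by (simp flip: exp_of_nat_mult)
  then show ?thesis by (simp add: scaled_root_def power_mult_distrib)
qed

lemma norm_less_of_power_eq:
  fixes z y :: complex
  assumes "R > 0" "z ^ d = of_real R ^ d * y" "norm y < 1" 
  shows "norm z < R"
proof -
  have "norm z ^ d = R ^ d * norm y"
    using assms(1,2) by (metis abs_of_pos norm_mult norm_of_real norm_power)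
  also have "\<dots> < R ^ d * 1" using assms by (intro mult_strict_left_mono) auto
  finally have "norm z ^ d < R ^ d" by simp
  then show ?thesis by (rule power_less_imp_less_base) (use assms(1) in simp)
qed

text \<open>The reduced series \<open>\<phi>\<close> with \<open>f z = z ^ r * \<phi> ((z / R) ^ d)\<close>; it has a single singularity on the unit circle.\<close>

definition reduced_fps :: "real \<Rightarrow> nat \<Rightarrow> nat \<Rightarrow> complex fps \<Rightarrow> complex fps" where
  "reduced_fps R d r a = Abs_fps (\<lambda>n. fps_nth a (d * n + r) * of_real R ^ (d * n))"

lemma reduced_fps:
  assumes R: "R > 0" and d: "d > 0" and r: "r < d"
    and f: "f has_fps_expansion a" "f holomorphic_on ball 0 R"
    and zero: "\<And>n. \<not> [n = r] (mod d) \<Longrightarrow> fps_nth a n = 0"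
  shows reduced_fps_conv_radius: "fps_conv_radius (reduced_fps R d r a) \<ge> 1"
    and eval_reduced_fps: "\<And>y z. norm y < 1 \<Longrightarrow> y \<noteq> 0 \<Longrightarrow> z ^ d = of_real R ^ d * y \<Longrightarrow>
          eval_fps (reduced_fps R d r a) y = f z / z ^ r"
proof -
  have sums: "(\<lambda>n. fps_nth (reduced_fps R d r a) n * y ^ n) sums (f z / z ^ r)"
    if y: "norm y < 1" "y \<noteq> 0" and z: "z ^ d = of_real R ^ d * y" for y z
  proof -
    have "norm z < R" by (rule norm_less_of_power_eq) fact+
    have "z \<noteq> 0" using z y R d by (auto simp: power_0_left)
    have "(\<lambda>n. fps_nth a n * z ^ n) sums f z"
      by (rule has_fps_expansion_imp_sums_complex[OF f(1), of "ereal R"]) (use f(2) \<open>norm z < R\<close> in auto)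
    moreover have "strict_mono (\<lambda>m. d * m + r)" using d by (auto simp: strict_mono_def)
    moreover have "fps_nth a n * z ^ n = 0" if n: "n \<notin> range (\<lambda>m. d * m + r)" for n
    proof -
      have "\<not> [n = r] (mod d)"
      proof
        assume "[n = r] (mod d)"
        then have "n mod d = r" using r by (simp add: cong_def)
        then have "n = d * (n div d) + r" by (metis mult_div_mod_eq)
        with n show False by blast
      qed
      then show ?thesis by (simp add: zero)
    qed
    ultimately have "(\<lambda>m. fps_nth a (d * m + r) * z ^ (d * m + r)) sums f z"
      by (subst sums_mono_reindex[where f = "\<lambda>n. fps_nth a n * z ^ n"]) auto
    from sums_divide[OF this, of "z ^ r"]
    have "(\<lambda>m. fps_nth a (d * m + r) * z ^ (d * m + r) / z ^ r) sums (f z / z ^ r)" .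
    moreover have "fps_nth a (d * m + r) * z ^ (d * m + r) / z ^ r = fps_nth (reduced_fps R d r a) m * y ^ m" for m
    proof -
      have "z ^ (d * m + r) / z ^ r = (z ^ d) ^ m"
        using \<open>z \<noteq> 0\<close> by (simp add: power_add power_mult)
      also have "\<dots> = of_real R ^ (d * m) * y ^ m"
        unfolding z by (simp add: power_mult_distrib power_mult)
      finally show ?thesis
        unfolding reduced_fps_def by (simp only: times_divide_eq_right[symmetric] fps_nth_Abs_fps mult.assoc)
    qed
    ultimately show ?thesis by simp
  qed
  show conv: "fps_conv_radius (reduced_fps R d r a) \<ge> 1"
    unfolding fps_conv_radius_def
  proof (rule conv_radius_geI_ex')
    fix \<rho> :: real assume "0 < \<rho>" "ereal \<rho> < 1"
    then show "summable (\<lambda>n. fps_nth (reduced_fps R d r a) n * of_real \<rho> ^ n)"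
      using sums[of "of_real \<rho>" "scaled_root R d (of_real \<rho>)"] d
      by (auto simp: scaled_root_power sums_iff)
  qed
  show "eval_fps (reduced_fps R d r a) y = f z / z ^ r"
    if "norm y < 1" "y \<noteq> 0" "z ^ d = of_real R ^ d * y" for y z
    using sums[OF that] by (simp add: eval_fps_def sums_iff)
qed

text \<open>A local branch \<open>\<xi>\<close> of the scaled root carries \<open>y0\<close> to a
  point of the circle of radius \<open>R\<close>, which is not exceptional because
  \<open>y0 \<noteq> 1\<close>. The extension \<open>F\<close> found there is pulled back along
  \<open>\<xi>\<close>.\<close>

lemma root_branch_extension:
  fixes f \<phi> :: "complex \<Rightarrow> complex"
  assumes R: "R > 0" and d: "d > 0"
    and \<phi>: "\<And>y z. norm y < 1 \<Longrightarrow> y \<noteq> 0 \<Longrightarrow> z ^ d = of_real R ^ d * y \<Longrightarrow> \<phi> y = f z / z ^ r"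
    and ext: "\<And>\<zeta>. norm \<zeta> = R \<Longrightarrow> \<zeta> ^ d \<noteq> of_real R ^ d \<Longrightarrow>
       \<exists>U F. open U \<and> \<zeta> \<in> U \<and> F holomorphic_on U \<and> (\<forall>z\<in>U \<inter> ball 0 R. F z = f z)"
    and y0: "y0 \<in> sphere 0 1 - {1}"
  shows "\<exists>U F. open U \<and> y0 \<in> U \<and> F holomorphic_on U \<and> (\<forall>y\<in>U \<inter> ball 0 1. F y = \<phi> y)"
proof -
  define z0 where "z0 = scaled_root R d y0"
  have y0': "norm y0 = 1" "y0 \<noteq> 0" "y0 \<noteq> 1" using y0 by auto
  have z0: "z0 ^ d = of_real R ^ d * y0"
    unfolding z0_def by (rule scaled_root_power) (use d y0' in auto)
  have "norm z0 ^ d = R ^ d"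
    using R z0 y0' by (metis abs_of_pos mult.right_neutral norm_mult norm_of_real norm_power)
  then have nz0: "norm z0 = R" using R d by (metis norm_ge_zero power_eq_imp_eq_base less_imp_le)
  have "z0 ^ d \<noteq> of_real R ^ d" using z0 y0' R by simp
  from ext[OF nz0 this] obtain U F where U: "open U" "z0 \<in> U" "F holomorphic_on U"
    "\<forall>z\<in>U \<inter> ball 0 R. F z = f z" by blast
  \<comment> \<open>The logarithm is applied to \<open>y / y0\<close>, which is \<open>1\<close> at
    the base point; \<open>Ln y\<close> would be discontinuous at \<open>y0 = -1\<close>.\<close>
  define \<xi> where "\<xi> = (\<lambda>y. z0 * exp (Ln (y / y0) / of_nat d))"
  define D where "D = (\<lambda>y. y / y0) -` (- \<real>\<^sub>\<le>\<^sub>0)"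
  have D: "open D" unfolding D_def
    by (intro continuous_open_vimage continuous_intros) (use y0' in auto)
  have \<xi>_holo: "\<xi> holomorphic_on D" unfolding \<xi>_def D_def
    by (intro holomorphic_intros) (use y0' d in auto)
  have \<xi>_pow: "\<xi> y ^ d = of_real R ^ d * y" if "y \<noteq> 0" for y
  proof -
    have "exp (Ln (y / y0) / of_nat d) ^ d = y / y0"
      using that y0' d by (simp flip: exp_of_nat_mult)
    then show ?thesis using y0' by (simp add: \<xi>_def power_mult_distrib z0)
  qed
  define W where "W = D \<inter> \<xi> -` U"
  have D0: "y \<noteq> 0" if "y \<in> D" for y using that by (auto simp: D_def)
  have \<xi>0: "\<xi> y \<noteq> 0" for y using nz0 R by (auto simp: \<xi>_def)
  have "open W" unfolding W_def
    by (rule continuous_open_preimage[OF holomorphic_on_imp_continuous_on[OF \<xi>_holo] D U(1)])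
  moreover have "y0 \<in> W" using y0' U(2) by (simp add: W_def D_def \<xi>_def)
  moreover have "(\<lambda>y. F (\<xi> y) / \<xi> y ^ r) holomorphic_on W"
  proof -
    have "\<xi> holomorphic_on W" using \<xi>_holo by (auto simp: W_def elim: holomorphic_on_subset)
    moreover from this have "(F \<circ> \<xi>) holomorphic_on W"
      by (rule holomorphic_on_compose_gen[OF _ U(3)]) (auto simp: W_def)
    ultimately show ?thesis using \<xi>0 by (auto intro!: holomorphic_intros simp: o_def)
  qed
  moreover have "F (\<xi> y) / \<xi> y ^ r = \<phi> y" if "y \<in> W \<inter> ball 0 1" for y
  proof -
    have y: "norm y < 1" "y \<noteq> 0" "\<xi> y \<in> U" using that D0 by (auto simp: W_def)
    have "norm (\<xi> y) < R" using norm_less_of_power_eq[OF R \<xi>_pow[OF y(2)] y(1)] .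
    then have "F (\<xi> y) = f (\<xi> y)" using U(4) y(3) by simp
    then show ?thesis using \<phi>[OF y(1,2) \<xi>_pow[OF y(2)]] by simp
  qed
  ultimately show ?thesis by blast
qed

section \<open>The square-root singularity at \<open>1\<close>\<close>

lemma deriv_scaled_power:
  fixes \<mu> :: "complex \<Rightarrow> complex"
  assumes "\<mu> analytic_on {0}" "\<mu> 0 = a" "a \<noteq> 0" "deriv \<mu> 0 = 0" "d > 0"
  defines "h \<equiv> \<lambda>w. (\<mu> w / a) ^ d"
  shows "h analytic_on {0}" "h 0 = 1" "deriv h 0 = 0"
    "deriv (deriv h) 0 = of_nat d / a * deriv (deriv \<mu>) 0"
proof -
  show "h analytic_on {0}" unfolding h_def by (intro analytic_intros assms(1)) (use assms(3) in auto)
  show "h 0 = 1" using assms by (simp add: h_def)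
  obtain S where S: "open S" "0 \<in> S" "\<mu> holomorphic_on S" using assms(1) analytic_at by blast
  have d\<mu>: "(\<mu> has_field_derivative deriv \<mu> w) (at w)" if "w \<in> S" for w
    using S that by (auto intro: holomorphic_derivI)
  have dh: "deriv h w = of_nat d * (\<mu> w / a) ^ (d - 1) * (deriv \<mu> w / a)" if "w \<in> S" for w
    unfolding h_def
    by (rule DERIV_imp_deriv) (use assms(3) in \<open>auto intro!: derivative_eq_intros d\<mu>[OF that]\<close>)
  show "deriv h 0 = 0" using dh[OF S(2)] assms(4) by simp
  have "deriv (deriv h) 0 = deriv (\<lambda>w. of_nat d * (\<mu> w / a) ^ (d - 1) * (deriv \<mu> w / a)) 0"
  proof (rule deriv_cong_ev)
    show "\<forall>\<^sub>F w in nhds 0. deriv h w = of_nat d * (\<mu> w / a) ^ (d - 1) * (deriv \<mu> w / a)"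
      using eventually_nhds_in_open[OF S(1,2)] by eventually_elim (rule dh)
  qed simp
  \<comment> \<open>Differentiating the power yields a term with the factor
    \<open>(deriv \<mu> 0)^2\<close>, which vanishes.\<close>
  also have "\<dots> = of_nat d / a * deriv (deriv \<mu>) 0"
  proof (rule DERIV_imp_deriv)
    have dd\<mu>: "(deriv \<mu> has_field_derivative deriv (deriv \<mu>) 0) (at 0)"
      using S by (auto intro: holomorphic_derivI holomorphic_deriv)
    show "((\<lambda>w. of_nat d * (\<mu> w / a) ^ (d - 1) * (deriv \<mu> w / a))
        has_field_derivative of_nat d / a * deriv (deriv \<mu>) 0) (at 0)"
      using assms(2-4) by (auto intro!: derivative_eq_intros d\<mu>[OF S(2)] dd\<mu>)
  qed
  finally show "deriv (deriv h) 0 = of_nat d / a * deriv (deriv \<mu>) 0" .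
qed

text \<open>The lift \<open>v\<close> need only be continuous: \<open>\<mu> (v z) = z\<close>
  determines the square of \<open>\<psi> (v z)\<close>, and continuity fixes its sign. Inverting
  \<open>\<psi>\<close> then expresses \<open>v z\<close>, and with it
  \<open>f z = \<gamma> (v z)\<close>, analytically through \<open>csqrt (1 - y)\<close>.\<close>

lemma square_root_singularity:
  fixes f \<phi> v \<mu> \<gamma> :: "complex \<Rightarrow> complex"
  assumes R: "R > 0" and d: "d > 0"
    and \<phi>: "\<And>y z. norm y < 1 \<Longrightarrow> y \<noteq> 0 \<Longrightarrow> z ^ d = of_real R ^ d * y \<Longrightarrow> \<phi> y = f z / z ^ r"
    and \<mu>: "\<mu> analytic_on {0}" "\<mu> 0 = of_real R" "deriv \<mu> 0 = 0" "deriv (deriv \<mu>) 0 \<noteq> 0"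
    and \<gamma>: "\<gamma> analytic_on {0}" "deriv \<gamma> 0 \<noteq> 0"
    and v: "\<delta> > 0" "continuous_on (ball 0 R \<inter> ball (of_real R) \<delta>) v"
      "(v \<longlongrightarrow> 0) (at (of_real R) within ball 0 R)"
    and lift: "\<And>z. z \<in> ball 0 R \<inter> ball (of_real R) \<delta> \<Longrightarrow> \<mu> (v z) = z \<and> \<gamma> (v z) = f z"
  obtains G where "G analytic_on {0}" "deriv G 0 \<noteq> 0"
    "\<forall>\<^sub>F y in at 1 within ball 0 1. \<phi> y = G (csqrt (1 - y))"
proof -
  have R0: "of_real R \<noteq> (0::complex)" using R by simp
  define h where "h = (\<lambda>w. (\<mu> w / of_real R) ^ d)"
  note h = deriv_scaled_power[OF \<mu>(1,2) R0 \<mu>(3) d, folded h_def]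
  have h0: "h 0 = 1" using h(2) by (simp add: h_def)
  have "deriv (deriv h) 0 \<noteq> 0" using h(4) \<mu>(4) R d by simp
  then obtain \<psi> where \<psi>: "\<psi> analytic_on {0}" "\<psi> 0 = 0" "deriv \<psi> 0 \<noteq> 0" "\<And>w. h 0 - h w = (\<psi> w)\<^sup>2"
    using square_normal_form[OF h(1,3)] by blast
  obtain \<eta> where \<eta>: "\<eta> analytic_on {0}" "deriv \<eta> 0 \<noteq> 0" "\<forall>\<^sub>F w in nhds 0. \<eta> (\<psi> w) = w"
    using analytic_local_inverse[OF \<psi>(1,3)] unfolding \<psi>(2) by blast
  have \<eta>0: "\<eta> 0 = 0" using eventually_nhds_x_imp_x[OF \<eta>(3)] \<psi>(2) by simp
  obtain T where T: "open T" "0 \<in> T" "\<psi> holomorphic_on T" using \<psi>(1) analytic_at by blast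
  have "\<forall>\<^sub>F w in nhds 0. w \<in> T \<and> \<eta> (\<psi> w) = w"
    using eventually_nhds_in_open[OF T(1,2)] \<eta>(3) by eventually_elim simp
  then obtain e where e: "e > 0" "\<And>w. norm w < e \<Longrightarrow> w \<in> T \<and> \<eta> (\<psi> w) = w"
    by (auto simp: eventually_nhds_metric)
  have "\<forall>\<^sub>F z in at (of_real R) within ball 0 R. dist (v z) 0 < e"
    using v(3) e(1) by (rule tendstoD)
  then obtain \<delta>1 where \<delta>1: "\<delta>1 > 0" "\<And>z. z \<in> ball 0 R \<Longrightarrow> z \<noteq> of_real R \<Longrightarrow> dist z (of_real R) < \<delta>1 \<Longrightarrow> norm (v z) < e"
    unfolding eventually_at by auto
  \<comment> \<open>Convex, hence connected, and small enough for \<open>v\<close> to land where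
    \<open>\<eta>\<close> inverts \<open>\<psi>\<close>.\<close>
  define S where "S = ball (0::complex) R \<inter> ball (of_real R) (min \<delta> \<delta>1)"
  have S_sub: "S \<subseteq> ball 0 R \<inter> ball (of_real R) \<delta>" by (auto simp: S_def)
  have vS: "norm (v z) < e" if "z \<in> S" for z
  proof -
    have "z \<noteq> of_real R" using that R by (auto simp: S_def)
    then show ?thesis
      using \<delta>1(2)[of z] that R by (auto simp: S_def dist_commute)
  qed
  have small: "norm ((z / of_real R) ^ d) < 1" if "z \<in> S" for z
  proof -
    have "norm z / R < 1" using that R by (auto simp: S_def)
    then show ?thesis using R d by (simp add: norm_power norm_divide power_less_one_iff)
  qed
  define q where "q = (\<lambda>z. csqrt (1 - (z / of_real R) ^ d))"
  have Re: "Re ((z / of_real R) ^ d) < 1" if "z \<in> S" for z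
    using small[OF that] complex_Re_le_cmod[of "(z / of_real R) ^ d"] by linarith
  have "connected S" unfolding S_def by (intro convex_connected convex_Int convex_ball)
  moreover have "continuous_on S (\<lambda>z. \<psi> (v z))"
  proof (rule continuous_on_compose2[of T \<psi>])
    show "continuous_on T \<psi>" using T(3) by (rule holomorphic_on_imp_continuous_on)
    show "continuous_on S v" using v(2) S_sub by (rule continuous_on_subset)
    show "v ` S \<subseteq> T" using vS e(2) by blast
  qed
  moreover have "continuous_on S q" unfolding q_def
  proof (rule continuous_on_compose2[of "- \<real>\<^sub>\<le>\<^sub>0" csqrt])
    show "continuous_on (- \<real>\<^sub>\<le>\<^sub>0) csqrt" by (rule continuous_on_csqrt)
    show "continuous_on S (\<lambda>z. 1 - (z / of_real R) ^ d)" by (intro continuous_intros) (use R in auto)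
    show "(\<lambda>z. 1 - (z / of_real R) ^ d) ` S \<subseteq> - \<real>\<^sub>\<le>\<^sub>0"
      using one_minus_notin_nonpos_Reals[OF Re] by blast
  qed
  moreover have "(\<psi> (v z))\<^sup>2 = (q z)\<^sup>2" if "z \<in> S" for z
  proof -
    have "\<mu> (v z) = z" using lift S_sub that by blast
    then have "h (v z) = (z / of_real R) ^ d" by (simp add: h_def)
    then show ?thesis using \<psi>(4)[of "v z"] by (simp add: q_def h0)
  qed
  moreover have "q z \<noteq> 0" if "z \<in> S" for z
    using small[OF that] by (auto simp: q_def)
  ultimately obtain \<sigma> where \<sigma>: "\<sigma> \<noteq> 0" "\<And>z. z \<in> S \<Longrightarrow> \<psi> (v z) = \<sigma> * q z"
    using continuous_square_root_sign by blast
  \<comment> \<open>\<open>\<eta> (\<sigma> * s)\<close> recovers \<open>v z\<close> from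
    \<open>s = csqrt (1 - y)\<close>, which makes the quotient \<open>f z / z ^ r\<close>.\<close>
  define G where "G = (\<lambda>s. \<gamma> (\<eta> (\<sigma> * s)) / \<mu> (\<eta> (\<sigma> * s)) ^ r)"
  show thesis
  proof
    have lin: "(\<lambda>s. \<sigma> * s) analytic_on {0}" by (intro analytic_intros)
    have \<eta>\<sigma>: "(\<lambda>s. \<eta> (\<sigma> * s)) analytic_on {0}"
      using analytic_on_compose_gen[OF lin \<eta>(1)] by (simp add: o_def)
    have an: "(\<lambda>s. F (\<eta> (\<sigma> * s))) analytic_on {0}" if "F analytic_on {0}" for F
      using analytic_on_compose_gen[OF \<eta>\<sigma> that] \<eta>0 by (simp add: o_def)
    show "G analytic_on {0}" unfolding G_def
      by (intro analytic_intros an \<gamma> \<mu>) (use \<eta>0 \<mu>(2) R in auto)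
    have dx: "((\<lambda>s. \<eta> (\<sigma> * s)) has_field_derivative deriv \<eta> 0 * \<sigma>) (at 0)"
      using DERIV_chain2[of \<eta> "deriv \<eta> 0" "\<lambda>s. \<sigma> * s" 0 \<sigma> UNIV] \<eta>(1) analytic_derivI
      by (auto intro!: derivative_eq_intros)
    have dF: "((\<lambda>s. F (\<eta> (\<sigma> * s))) has_field_derivative deriv F 0 * (deriv \<eta> 0 * \<sigma>)) (at 0)"
      if "F analytic_on {0}" for F
      by (rule DERIV_chain2[OF _ dx]) (use that \<eta>0 analytic_derivI in auto)
    \<comment> \<open>The denominator has no first-order term because
      \<open>deriv \<mu> 0 = 0\<close>.\<close>
    have "(G has_field_derivative deriv \<gamma> 0 * (deriv \<eta> 0 * \<sigma>) / of_real R ^ r) (at 0)"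
      unfolding G_def using \<mu>(2,3) \<eta>0 R
      by (auto intro!: derivative_eq_intros dF[OF \<gamma>(1)] dF[OF \<mu>(1)])
    then have "deriv G 0 = deriv \<gamma> 0 * (deriv \<eta> 0 * \<sigma>) / of_real R ^ r" by (rule DERIV_imp_deriv)
    then show "deriv G 0 \<noteq> 0" using \<gamma>(2) \<eta>(2) \<sigma>(1) R by simp
  next
    have "isCont (scaled_root R d) 1" unfolding scaled_root_def by (intro continuous_intros) (use d in auto)
    then have "scaled_root R d \<midarrow>1\<rightarrow> of_real R" by (simp add: isCont_def scaled_root_def)
    then have "((scaled_root R d) \<longlongrightarrow> of_real R) (at 1 within ball 0 1)"
      by (rule tendsto_within_subset) simp
    then have "\<forall>\<^sub>F y in at 1 within ball 0 1. dist (scaled_root R d y) (of_real R) < min \<delta> \<delta>1"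
      using v(1) \<delta>1(1) by (intro tendstoD) auto
    moreover have "\<forall>\<^sub>F y in at 1 within ball 0 1. y \<in> ball 0 1 \<and> y \<noteq> (0::complex)"
      unfolding eventually_at by (intro exI[of _ 1]) auto
    ultimately show "\<forall>\<^sub>F y in at 1 within ball 0 1. \<phi> y = G (csqrt (1 - y))"
    proof eventually_elim
      case (elim y)
      define z where "z = scaled_root R d y"
      have zd: "z ^ d = of_real R ^ d * y" unfolding z_def by (rule scaled_root_power) (use d elim in auto)
      have "norm z < R" using norm_less_of_power_eq[OF R zd] elim by simp
      with elim have zS: "z \<in> S" by (simp add: S_def z_def dist_commute)
      have "q z = csqrt (1 - y)" using zd R by (simp add: q_def power_divide)
      with \<sigma>(2)[OF zS] have "\<psi> (v z) = \<sigma> * csqrt (1 - y)" by simp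
      with e(2)[OF vS[OF zS]] have "v z = \<eta> (\<sigma> * csqrt (1 - y))" by simp
      moreover have "\<mu> (v z) = z \<and> \<gamma> (v z) = f z" using lift S_sub zS by blast
      moreover have "\<phi> y = f z / z ^ r" using \<phi>[OF _ _ zd] elim by simp
      ultimately show ?case by (simp add: G_def)
    qed
  qed
qed

section \<open>The coefficient asymptotics\<close>

text \<open>By convention \<open>Gamma\<close> is \<open>0\<close> at its poles and nowhere else, so
  it remains to see that \<open>- (1 / 2)\<close> is not an integer.\<close>

lemma Gamma_minus_half_nonzero: "Gamma (- (1 / 2) :: complex) \<noteq> 0"
proof -
  have "- (1 / 2) \<notin> (\<int>\<^sub>\<le>\<^sub>0 :: complex set)"
  proof
    assume "- (1 / 2) \<in> (\<int>\<^sub>\<le>\<^sub>0 :: complex set)"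
    then obtain n where "- (1 / 2 :: complex) = of_int n" by (auto elim: nonpos_Ints_cases)
    then have "of_int (- 1) = (of_int (2 * n) :: complex)" by (simp add: field_simps)
    then have "- 1 = 2 * n" by (simp only: of_int_eq_iff)
    then show False by presburger
  qed
  then show ?thesis by (simp add: Gamma_eq_zero_iff)
qed

theorem corollary4p1:
  fixes R :: real and d r :: nat
    and \<A> :: "('a::t2_space set \<times> ('a \<Rightarrow> complex)) set"
    and A :: "'a \<Rightarrow> 'a"
    and u :: "complex \<Rightarrow> 'a"
    and lam g :: "'a \<Rightarrow> complex"
    and V Up :: "'a set"
    and c :: "'a \<Rightarrow> complex"
    and a :: "complex fps"
  assumes R_pos: "R > 0" and d_pos: "d > 0"
    and surface: "riemann_surface \<A>"
    and aut: "automorphism \<A> A"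
    and order: "A ^^ d = id" "\<forall>k\<in>{1..<d}. A ^^ k \<noteq> id"
    and u_holo: "holomorphic_map_on plane_atlas \<A> (ball 0 R) u"
    and lam_holo: "holomorphic_map_on \<A> plane_atlas UNIV lam"
    and V_nbhd: "open V" "closure (u ` ball 0 R) \<subseteq> V"
    and g_holo: "holomorphic_map_on \<A> plane_atlas V g"
    and expansion: "(g \<circ> u) has_fps_expansion a"
    and i: "\<forall>z\<in>ball 0 R. lam (u z) = z"
    and ii: "continuous_on (cball 0 R) u"
    and chart: "holomorphic_chart \<A> Up c" "u (of_real R) \<in> Up" "c (u (of_real R)) = 0"
    and iii: "deriv (lam \<circ> inv_into Up c) 0 = 0"
    and iv: "deriv (deriv (lam \<circ> inv_into Up c)) 0 \<noteq> 0"
    and v: "\<forall>\<zeta>\<in>sphere 0 R - {of_real R * cis (2 * pi * real k / real d) | k. k < d}.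
              \<exists>U w. open U \<and> \<zeta> \<in> U \<and> holomorphic_map_on plane_atlas \<A> U w \<and>
                    (\<forall>z\<in>U \<inter> ball 0 R. w z = u z)"
    and vi: "deriv (g \<circ> inv_into Up c) 0 \<noteq> 0"
    and vii: "\<forall>k\<in>{1..<d}. {q. (A ^^ k) q = q} = {u 0}"
             "\<forall>z\<in>ball 0 R. u (cis (2 * pi / real d) * z) = A (u z)"
    and viii: "r < d"
              "\<forall>q\<in>closure (u ` ball 0 R). g (A q) = cis (2 * pi * real r / real d) * g q"
  shows "(\<forall>n. \<not> [n = r] (mod d) \<longrightarrow> fps_nth a n = 0) \<and>
         (\<exists>C. C \<noteq> 0 \<and>
           (\<exists>!b. b \<in> {1::nat..} \<rightarrow>\<^sub>E (UNIV :: complex set) \<and>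
             (\<forall>K\<ge>1. \<exists>E\<in>O(\<lambda>n. 1 / of_nat n ^ (K + 1)).
               \<forall>\<^sub>F n in sequentially.
                 fps_nth a (d * n + r) =
                   C * of_real (R powi (- int (d * n))) * of_real (1 / real n powr (3 / 2)) *
                   (1 + (\<Sum>l=1..K. b l / of_nat n ^ l) + E n))))"
proof -
  define f where "f = g \<circ> u"
  have in_closure: "u z \<in> closure (u ` ball 0 R)" if "z \<in> ball 0 R" for z
    using that by (intro subsetD[OF closure_subset] imageI)
  have f_holo: "f holomorphic_on ball 0 R"
    unfolding f_def
    by (rule holomorphic_on_subset[OF holomorphic_compose_map(1)[OF surface u_holo open_ball g_holo V_nbhd(1)]])
       (use in_closure V_nbhd(2) in blast)
  have f_exp: "f has_fps_expansion a" using expansion by (simp only: f_def)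
  have zero: "fps_nth a n = 0" if "\<not> [n = r] (mod d)" for n
  proof (rule fps_nth_eq_0_of_rotation[OF R_pos d_pos f_exp _ that])
    fix z :: complex assume z: "z \<in> ball 0 R"
    then show "f (cis (2 * pi / real d) * z) = cis (2 * pi * real r / real d) * f z"
      using vii(2) viii(2) in_closure[OF z] by (simp add: f_def)
  qed
  define \<phi> where "\<phi> = eval_fps (reduced_fps R d r a)"
  note reduced = reduced_fps[OF R_pos d_pos viii(1) f_exp f_holo zero]
  have \<phi>: "\<phi> y = f z / z ^ r" if "norm y < 1" "y \<noteq> 0" "z ^ d = of_real R ^ d * y" for y z
    unfolding \<phi>_def by (rule reduced(2)) (use that in auto)
  have conv: "fps_conv_radius (reduced_fps R d r a) \<ge> 1" by (rule reduced(1))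
  have \<phi>_holo: "\<phi> holomorphic_on ball 0 1"
    unfolding \<phi>_def
  proof (rule holomorphic_on_eval_fps, rule subsetI)
    fix z :: complex assume "z \<in> ball 0 1"
    then have "ereal (norm z) < 1" by simp
    also note conv
    finally show "z \<in> eball 0 (fps_conv_radius (reduced_fps R d r a))" by (simp add: in_eball_iff)
  qed
  have \<phi>_exp: "fps_expansion \<phi> 0 = reduced_fps R d r a"
  proof (rule fps_expansion_unique_complex)
    show "\<phi> has_fps_expansion fps_expansion \<phi> 0"
      by (rule has_fps_expansion_fps_expansion[OF _ _ \<phi>_holo]) auto
    show "\<phi> has_fps_expansion reduced_fps R d r a"
      unfolding \<phi>_def
      by (rule eval_fps_has_fps_expansion) (use conv in \<open>auto intro: less_le_trans[of 0 "1::ereal"]\<close>)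
  qed
  have ext: "\<exists>U F. open U \<and> \<zeta> \<in> U \<and> F holomorphic_on U \<and> (\<forall>z\<in>U \<inter> ball 0 R. F z = f z)"
    if \<zeta>: "norm \<zeta> = R" "\<zeta> ^ d \<noteq> of_real R ^ d" for \<zeta>
  proof -
    have "\<zeta> \<noteq> of_real R * cis (2 * pi * real k / real d)" for k
    proof
      assume eq: "\<zeta> = of_real R * cis (2 * pi * real k / real d)"
      have "cis (2 * pi * real k / real d) ^ d = cis (2 * pi * real k)"
        using d_pos by (simp add: Complex.DeMoivre)
      also have "\<dots> = 1" by (rule cis_multiple_2pi) simp
      finally show False using \<zeta>(2) by (simp add: eq power_mult_distrib)
    qed
    then have "\<zeta> \<in> sphere 0 R - {of_real R * cis (2 * pi * real k / real d) | k. k < d}"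
      using \<zeta>(1) by auto
    then obtain U w where U: "open U" "\<zeta> \<in> U" "holomorphic_map_on plane_atlas \<A> U w"
      "\<forall>z\<in>U \<inter> ball 0 R. w z = u z" using v by blast
    \<comment> \<open>This allows composing \<open>w\<close> with \<open>g\<close>, which is
      holomorphic only on \<open>V\<close>. If \<open>w \<zeta>\<close> lay outside the closure, so
      would \<open>w\<close> near \<open>\<zeta>\<close>; but every neighbourhood of
      \<open>\<zeta>\<close> meets the disc, where \<open>w\<close> is \<open>u\<close>.\<close>
    have "w \<zeta> \<in> closure (u ` ball 0 R)"
    proof (rule ccontr)
      assume "w \<zeta> \<notin> closure (u ` ball 0 R)"
      define N where "N = U \<inter> w -` (- closure (u ` ball 0 R))"
      have "continuous_on U w" using U(3) by (simp add: holomorphic_map_on_def)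
      then have "open N" unfolding N_def by (rule continuous_open_preimage[OF _ U(1)]) auto
      moreover have "N \<inter> closure (ball 0 R) \<noteq> {}"
        using \<open>w \<zeta> \<notin> _\<close> U(2) \<zeta>(1) R_pos by (auto simp: N_def)
      ultimately have "N \<inter> ball 0 R \<noteq> {}" by (simp add: open_Int_closure_eq_empty)
      then obtain z where z: "z \<in> U" "z \<in> ball 0 R" "w z \<notin> closure (u ` ball 0 R)"
        unfolding N_def by blast
      then have "w z = u z" using U(4) by blast
      with z in_closure[of z] show False by simp
    qed
    then have "\<zeta> \<in> U \<inter> w -` V" using U(2) V_nbhd(2) by blast
    moreover note holomorphic_compose_map[OF surface U(3,1) g_holo V_nbhd(1)]
    moreover have "(g \<circ> w) z = f z" if "z \<in> (U \<inter> w -` V) \<inter> ball 0 R" for z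
      using that U(4) by (simp add: f_def)
    ultimately show ?thesis by blast
  qed
  have up_closure: "u (of_real R) \<in> closure (u ` ball 0 R)"
  proof -
    have "u ` closure (ball 0 R) \<subseteq> closure (u ` ball 0 R)"
      by (rule image_closure_subset) (use ii R_pos in \<open>auto intro: in_closure\<close>)
    then show ?thesis using R_pos by auto
  qed
  \<comment> \<open>Assumption i persists on the closed disc by continuity, which identifies the
    critical value of \<open>lam\<close> at \<open>p\<close> as \<open>R\<close>.\<close>
  have lam_p: "lam (u (of_real R)) = of_real R"
  proof -
    have "continuous_on UNIV lam" using lam_holo by (simp add: holomorphic_map_on_def)
    then have "continuous_on (cball 0 R) (\<lambda>z. lam (u z) - z)"
      by (intro continuous_intros continuous_on_compose2[OF _ ii]) auto
    then have "continuous_on (closure (ball 0 R)) (\<lambda>z. lam (u z) - z)" using R_pos by simp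
    from continuous_constant_on_closure[OF this, of 0 "of_real R"] show ?thesis
      using R_pos i by simp
  qed
  have Up: "complex_chart Up c" "open Up" using chart(1) by (auto simp: holomorphic_chart_def complex_chart_def)
  have inv0: "inv_into Up c 0 = u (of_real R)"
    using complex_chart_inv_into[OF Up(1) chart(2)] by (simp add: chart(3))
  define \<mu> where "\<mu> = lam \<circ> inv_into Up c"
  define \<gamma> where "\<gamma> = g \<circ> inv_into Up c"
  have \<mu>_an: "\<mu> analytic_on {0}"
  proof -
    have "\<mu> holomorphic_on c ` (UNIV \<inter> Up)"
      unfolding \<mu>_def by (rule holomorphic_in_chart[OF surface chart(1) lam_holo]) simp
    moreover have "open (c ` (UNIV \<inter> Up))" using Up by (intro complex_chart_open_image[of Up]) auto
    moreover have "0 \<in> c ` (UNIV \<inter> Up)" using chart(2,3) by force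
    ultimately show ?thesis using analytic_at by blast
  qed
  have \<gamma>_an: "\<gamma> analytic_on {0}"
  proof -
    have "\<gamma> holomorphic_on c ` (V \<inter> Up)"
      unfolding \<gamma>_def by (rule holomorphic_in_chart[OF surface chart(1) g_holo V_nbhd(1)])
    moreover have "open (c ` (V \<inter> Up))" using Up V_nbhd(1) by (intro complex_chart_open_image[of Up]) auto
    moreover have "0 \<in> c ` (V \<inter> Up)" using chart(2,3) up_closure V_nbhd(2) by force
    ultimately show ?thesis using analytic_at by blast
  qed
  have cont_v: "continuous_on (cball 0 R \<inter> u -` Up) (c \<circ> u)"
    by (rule continuous_on_compose)
       (use ii complex_chart_continuous_on[OF Up(1)] in \<open>auto elim: continuous_on_subset\<close>)
  have u_lim: "(u \<longlongrightarrow> u (of_real R)) (at (of_real R) within cball 0 R)"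
    using ii R_pos by (auto simp: continuous_on_def)
  then have "\<forall>\<^sub>F z in at (of_real R) within cball 0 R. u z \<in> Up"
    using Up(2) chart(2) by (rule topological_tendstoD)
  then obtain \<delta> where \<delta>: "\<delta> > 0"
    "\<And>z. z \<in> cball 0 R \<Longrightarrow> z \<noteq> of_real R \<Longrightarrow> dist z (of_real R) < \<delta> \<Longrightarrow> u z \<in> Up"
    unfolding eventually_at by blast
  have u_Up: "u z \<in> Up" if "z \<in> ball 0 R \<inter> ball (of_real R) \<delta>" for z
  proof -
    have "z \<noteq> of_real R" using that R_pos by auto
    then show ?thesis using \<delta>(2)[of z] that by (auto simp: dist_commute)
  qed
  have v_lim: "((c \<circ> u) \<longlongrightarrow> 0) (at (of_real R) within ball 0 R)"
  proof -
    have "isCont c (u (of_real R))"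
      using complex_chart_continuous_on[OF Up(1)] Up(2) chart(2) by (simp add: continuous_on_eq_continuous_at)
    then have "((\<lambda>z. c (u z)) \<longlongrightarrow> c (u (of_real R))) (at (of_real R) within cball 0 R)"
      using u_lim by (rule isCont_tendsto_compose)
    then show ?thesis
      unfolding chart(3) o_def by (rule tendsto_within_subset) auto
  qed
  have \<mu>0: "\<mu> 0 = of_real R" by (simp add: \<mu>_def inv0 lam_p)
  have derivs: "deriv \<mu> 0 = 0" "deriv (deriv \<mu>) 0 \<noteq> 0" "deriv \<gamma> 0 \<noteq> 0"
    using iii iv vi by (simp_all add: \<mu>_def \<gamma>_def)
  have v_cont: "continuous_on (ball 0 R \<inter> ball (of_real R) \<delta>) (c \<circ> u)"
    by (rule continuous_on_subset[OF cont_v]) (use u_Up in auto)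
  have lift: "\<mu> ((c \<circ> u) z) = z \<and> \<gamma> ((c \<circ> u) z) = f z"
    if "z \<in> ball 0 R \<inter> ball (of_real R) \<delta>" for z
    using that i complex_chart_inv_into[OF Up(1) u_Up[OF that]] by (simp add: \<mu>_def \<gamma>_def f_def)
  obtain G where G: "G analytic_on {0}" "deriv G 0 \<noteq> 0"
    "\<forall>\<^sub>F y in at 1 within ball 0 1. \<phi> y = G (csqrt (1 - y))"
    by (rule square_root_singularity[where \<phi> = \<phi> and f = f and r = r,
          OF R_pos d_pos \<phi> \<mu>_an \<mu>0 derivs(1,2) \<gamma>_an derivs(3) \<delta>(1) v_cont v_lim lift])
  define w where "w = (\<lambda>n. of_real (real n powr (3 / 2)) * fps_nth (reduced_fps R d r a) n)"
  define C where "C = deriv G 0 * inverse (Gamma (- (1 / 2)))"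
  have "C \<noteq> 0" using G(2) Gamma_minus_half_nonzero by (simp add: C_def)
  note darboux = darboux_square_root[OF \<phi>_holo root_branch_extension[OF R_pos d_pos \<phi> ext] G(1,3),
    unfolded \<phi>_exp, folded w_def C_def]
  have unique: "\<exists>!b. b \<in> {1::nat..} \<rightarrow>\<^sub>E (UNIV :: complex set) \<and>
     (\<forall>K\<ge>1. \<exists>E\<in>O(\<lambda>n. 1 / of_nat n ^ (K + 1)).
        \<forall>\<^sub>F n in sequentially. w n = C * (1 + (\<Sum>l=1..K. b l / of_nat n ^ l) + E n))"
    by (rule asymptotic_series_unique_existence[OF _ _ \<open>C \<noteq> 0\<close>]) (rule darboux; assumption)+
  \<comment> \<open>An equivalence, because uniqueness has to be transferred along with existence.
    Index \<open>0\<close>, where \<open>n powr (3 / 2)\<close> is \<open>0\<close>, is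
    excluded.\<close>
  have rescale: "(\<forall>\<^sub>F n in sequentially. fps_nth a (d * n + r) =
      C * of_real (R powi (- int (d * n))) * of_real (1 / real n powr (3 / 2)) * X n) \<longleftrightarrow>
      (\<forall>\<^sub>F n in sequentially. w n = C * X n)" for X :: "nat \<Rightarrow> complex"
  proof (rule eventually_cong[OF eventually_gt_at_top[of 0]])
    fix n :: nat assume "n > 0"
    then have nz: "of_real (real n powr (3 / 2)) \<noteq> (0::complex)" by simp
    have "w n = of_real (real n powr (3 / 2)) * (fps_nth a (d * n + r) * of_real R ^ (d * n))"
      by (simp add: w_def reduced_fps_def)
    moreover have "of_real (R powi (- int (d * n))) = (1 / of_real R ^ (d * n) :: complex)"
      by (simp only: power_int_minus power_int_of_nat of_real_power of_real_divide of_real_1 inverse_eq_divide)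
    ultimately show "fps_nth a (d * n + r) =
      C * of_real (R powi (- int (d * n))) * of_real (1 / real n powr (3 / 2)) * X n \<longleftrightarrow> w n = C * X n"
      using nz R_pos by (simp only: of_real_divide of_real_1) (simp add: field_simps)
  qed
  show ?thesis
    by (intro conjI exI[of _ C] allI impI zero \<open>C \<noteq> 0\<close> unique[folded rescale])
qed

end
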